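(* The admissible elements $e_\alpha$ and $f_{\alpha0}$ of $D^4$ whose admissible sequence $\alpha$ ends at $1$ are obtained by means of Herrmann's endomorphisms as follows: $$\gamma_{12}^t\gamma_{13}^s\gamma_{14}^r(e_1)=e_1a^{34}_ta^{24}_sa^{32}_r,$$ and $$\gamma_{12}^t\gamma_{13}^s\gamma_{14}^r(f_{10})=e_1a^{34}_ta^{24}_sa^{32}_r\,(e_1a^{34}_{t+1}+a^{24}_{s+1}a^{32}_{r-1})\quad\text{for } r\ge1.$$ Similarly, the admissible elements $e_\alpha$ and $f_{\alpha0}$ ending at $i=2,3,4$ are obtained as follows: $$\gamma_{12}^t\gamma_{13}^s\gamma_{14}^r(e_2)=e_2a^{34}_ta^{14}_sa^{13}_r,$$ $$\gamma_{12}^t\gamma_{13}^s\gamma_{14}^r(e_3)=e_3a^{14}_ta^{24}_sa^{12}_r,$$ $$\gamma_{12}^t\gamma_{13}^s\gamma_{14}^r(e_4)=e_4a^{31}_ta^{21}_sa^{23}_r,$$ and $$\gamma_{12}^t\gamma_{13}^s\gamma_{14}^r(f_{20})=e_2a^{34}_ta^{14}_sa^{31}_r\,(e_2a^{34}_{t+1}+a^{14}_{s+1}a^{31}_{r-1})\quad\text{for } r\ge1,$$ $$\gamma_{12}^t\gamma_{13}^s\gamma_{14}^r(f_{30})=e_3a^{14}_ta^{24}_sa^{12}_r\,(e_3a^{14}_{t+1}+a^{24}_{s+1}a^{12}_{r-1})\quad\text{for } r\ge1,$$ $$\gamma_{12}^t\gamma_{13}^s\gamma_{14}^r(f_{40})=e_4a^{31}_ta^{21}_sa^{32}_r\,(e_4a^{31}_{t+1}+a^{21}_{s+1}a^{32}_{r-1})\quad\text{for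 } r\ge1.$$ Here $r,s,t$ are non-negative integers.
   Context: **Lattice.** $D^4$ is the free modular lattice generated by $e_1,e_2,e_3,e_4$, with least element $0$ and greatest element $I$. Join is written $+$, meet is written as juxtaposition (meet binds more tightly than join). **Herrmann's endomorphisms.** For $\{i,j,k,l\}=\{1,2,3,4\}$ put $q_{ij}=q_{ji}=q_{kl}=q_{lk}=(e_i+e_j)(e_k+e_l)$. $\gamma_{ij}$ is the endomorphism of $D^4$ with $I\mapsto q_{ij}$, $0\mapsto 0$, $e_m\mapsto e_m q_{ij}$ ($m=1,2,3,4$). Products and powers of $\gamma$'s denote composition. **Atomic elements.** For $\{i,j,k,l\}=\{1,2,3,4\}$: $a^{ij}_0=I$ and $a^{ij}_n=e_i+e_j a^{kl}_{n-1}$ for $n\ge1$ (here $e_ja^{kl}_{n-1}=e_ja^{lk}_{n-1}$). **Admissible sequences.** An admissible sequence is a finite sequence $\alpha=i_n\dots i_1$ with entries in $\{1,2,3,4\}$ and $i_p\ne i_{p+1}$, where consecutive entries $ijl$ may be replaced by $ikl$ for $\{i,j,k,l\}=\{1,2,3,4\}$ (the two sequences are identified). $i_1$ is the start, $i_n$ is the end. $(pq)^t$ denotes $pq$ repeated $t$ times. **Admissible elements.** For an admissible sequence $\alpha$ starting at $1$, which is of one of the following types, $e_\alpha$ and $f_{\alpha0}$ are defined as follows (the different expressions given for one element are equal; every lower index has to be non-negative): - $(21)^t(41)^r(31)^s$: $e_\alpha=e_2a^{31}_{2s}a^{41}_{2r}a^{34}_{2t-1}$, $f_{\alpha0}=e_\alpha(e_2a^{34}_{2t}+a^{41}_{2r+1}a^{31}_{2s-1})=e_\alpha(a^{43}_{2t}+e_1a^{24}_{2r}a^{23}_{2s})$;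 - $(31)^s(41)^r(21)^t$: $e_\alpha=e_3a^{21}_{2t}a^{41}_{2r}a^{24}_{2s-1}$, $f_{\alpha0}=e_\alpha(e_3a^{42}_{2s}+a^{41}_{2r+1}a^{21}_{2t-1})=e_\alpha(a^{42}_{2s}+e_1a^{34}_{2r}a^{32}_{2t})$; - $(41)^r(31)^s(21)^t$: $e_\alpha=e_4a^{21}_{2t}a^{31}_{2s}a^{32}_{2r-1}$, $f_{\alpha0}=e_\alpha(e_4a^{32}_{2r}+a^{31}_{2s+1}a^{21}_{2t-1})=e_\alpha(a^{32}_{2r}+e_1a^{43}_{2s}a^{42}_{2t})$; - $1(41)^r(31)^s(21)^t$: $e_\alpha=e_1a^{24}_{2s}a^{34}_{2t}a^{32}_{2r}$, $f_{\alpha0}=e_\alpha(e_1a^{32}_{2r+1}+a^{24}_{2s+1}a^{34}_{2t-1})=e_\alpha(a^{32}_{2r+1}+e_4a^{21}_{2s}a^{31}_{2t})$; - $2(41)^r(31)^s(21)^t$: $e_\alpha=e_2a^{34}_{2t}a^{31}_{2s+1}a^{14}_{2r-1}=e_2a^{34}_{2t}a^{31}_{2s-1}a^{14}_{2r+1}$, $f_{\alpha0}=e_\alpha(e_2a^{14}_{2r}+a^{31}_{2s+2}a^{34}_{2t-1})=e_\alpha(a^{14}_{2r}+e_3a^{21}_{2s+1}a^{24}_{2t})$; - $3(41)^r(21)^t(31)^s$: $e_\alpha=e_3a^{24}_{2s}a^{21}_{2t+1}a^{14}_{2r-1}=e_3a^{24}_{2s}a^{21}_{2t-1}a^{14}_{2r+1}$,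 $f_{\alpha0}=e_\alpha(e_3a^{14}_{2r}+a^{21}_{2t+2}a^{24}_{2s-1})=e_\alpha(a^{14}_{2r}+e_2a^{31}_{2t+1}a^{34}_{2s})$; - $4(21)^t(31)^s(41)^r$: $e_\alpha=e_4a^{32}_{2r}a^{31}_{2s+1}a^{12}_{2t-1}=e_4a^{32}_{2r}a^{31}_{2s-1}a^{12}_{2t+1}$, $f_{\alpha0}=e_\alpha(e_4a^{12}_{2t}+a^{31}_{2s}a^{32}_{2r+1})=e_\alpha(a^{12}_{2t}+e_3a^{41}_{2s+1}a^{42}_{2r})$; - $(14)^r(31)^s(21)^t$: $e_\alpha=e_1a^{23}_{2r+1}a^{24}_{2s-1}a^{34}_{2t-1}=e_1a^{23}_{2r-1}a^{24}_{2s-1}a^{34}_{2t+1}=e_1a^{23}_{2r-1}a^{24}_{2s+1}a^{34}_{2t-1}$, $f_{\alpha0}=e_\alpha(e_1a^{23}_{2r}+a^{24}_{2s}a^{34}_{2t})=e_\alpha(e_1a^{24}_{2s}+a^{34}_{2t}a^{23}_{2r})=e_\alpha(e_1a^{34}_{2t}+a^{23}_{2r}a^{24}_{2s})$. For sequences starting at $m\ne1$, permute the indices accordingly (interchange $1$ and $m$ everywhere). In particular $f_{i0}=e_i(e_j+e_k+e_l)$ for $\{i,j,k,l\}=\{1,2,3,4\}$. An admissible element "ends at $i$" if its admissible sequence ends at $i$.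
   Formalization: For i=2,3,4 the left sides are γ12^tγ14^sγ13^r, γ14^tγ13^sγ12^r, γ13^tγ12^sγ14^r (as printed false: γ14(e2)=e2(e1+e4), not e2(e1+e3)); in the last four types of admissible sequences, unequal alternative expressions for e_α, f_α0 are dropped or corrected. *)

theory Defs
  imports "HOL-Library.Numeral_Type" "HOL-Combinatorics.Transposition"
begin

unbundle lattice_syntax

text \<open>The index set \<open>{1,2,3,4}\<close> is the four-element type \<^typ>\<open>4\<close>, whose arithmetic (modulo 4) is
  never used: \<open>{i,j,k,l} = {1,2,3,4}\<close> is written \<open>{i,j,k,l} = (UNIV :: 4 set)\<close>.\<close>

lemma index_cases: "(i::4) = 1 \<or> i = 2 \<or> i = 3 \<or> i = 4"
proof (cases i)
  case (of_int z)
  then have "z = 0 \<or> z = 1 \<or> z = 2 \<or> z = 3" by auto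
  then show ?thesis using of_int by auto
qed

lemma UNIV_index: "(UNIV :: 4 set) = {1,2,3,4}"
  using index_cases by auto

section \<open>The free modular lattice with \<open>0\<close> and \<open>I\<close> on four generators\<close>

text \<open>\<open>I\<close> has to be a free greatest element, not \<open>e\<^sub>1 + e\<^sub>2 + e\<^sub>3 + e\<^sub>4\<close>: otherwise Herrmann's
  endomorphisms could not map \<open>I\<close> to \<open>q\<^sub>i\<^sub>j\<close>.\<close>

datatype trm = Zero | One | Gen 4 | Join trm trm | Meet trm trm

text \<open>The equational theory of modular lattices with least and greatest element.\<close>

inductive trm_eq :: "trm \<Rightarrow> trm \<Rightarrow> bool" where
  refl: "trm_eq x x"
| sym: "trm_eq x y \<Longrightarrow> trm_eq y x"
| trans: "trm_eq x y \<Longrightarrow> trm_eq y z \<Longrightarrow> trm_eq x z"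
| cong_join: "trm_eq x x' \<Longrightarrow> trm_eq y y' \<Longrightarrow> trm_eq (Join x y) (Join x' y')"
| cong_meet: "trm_eq x x' \<Longrightarrow> trm_eq y y' \<Longrightarrow> trm_eq (Meet x y) (Meet x' y')"
| join_comm: "trm_eq (Join x y) (Join y x)"
| meet_comm: "trm_eq (Meet x y) (Meet y x)"
| join_assoc: "trm_eq (Join (Join x y) z) (Join x (Join y z))"
| meet_assoc: "trm_eq (Meet (Meet x y) z) (Meet x (Meet y z))"
| join_meet: "trm_eq (Join x (Meet x y)) x"
| meet_join: "trm_eq (Meet x (Join x y)) x"
| join_zero: "trm_eq (Join x Zero) x"
| meet_one: "trm_eq (Meet x One) x"
| modular: "trm_eq (Join (Meet x z) (Meet y z)) (Meet (Join (Meet x z) y) z)"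

quotient_type D4 = trm / trm_eq
proof (rule equivpI)
  show "reflp trm_eq" by (rule reflpI) (rule trm_eq.refl)
  show "symp trm_eq" by (rule sympI) (rule trm_eq.sym)
  show "transp trm_eq" by (rule transpI) (rule trm_eq.trans)
qed

instantiation D4 :: bounded_lattice
begin

lift_definition bot_D4 :: D4 is Zero .
lift_definition top_D4 :: D4 is One .
lift_definition sup_D4 :: "D4 \<Rightarrow> D4 \<Rightarrow> D4" is Join by (rule trm_eq.cong_join)
lift_definition inf_D4 :: "D4 \<Rightarrow> D4 \<Rightarrow> D4" is Meet by (rule trm_eq.cong_meet)

definition less_eq_D4 where "(x::D4) \<le> y \<longleftrightarrow> x \<sqinter> y = x"
definition less_D4 where "(x::D4) < y \<longleftrightarrow> x \<le> y \<and> x \<noteq> y"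

instance
proof
  have jc: "x \<squnion> y = y \<squnion> x" for x y :: D4 by transfer (rule trm_eq.join_comm)
  have mc: "x \<sqinter> y = y \<sqinter> x" for x y :: D4 by transfer (rule trm_eq.meet_comm)
  have ja: "(x \<squnion> y) \<squnion> z = x \<squnion> (y \<squnion> z)" for x y z :: D4 by transfer (rule trm_eq.join_assoc)
  have ma: "(x \<sqinter> y) \<sqinter> z = x \<sqinter> (y \<sqinter> z)" for x y z :: D4 by transfer (rule trm_eq.meet_assoc)
  have jm: "x \<squnion> (x \<sqinter> y) = x" for x y :: D4 by transfer (rule trm_eq.join_meet)
  have mj: "x \<sqinter> (x \<squnion> y) = x" for x y :: D4 by transfer (rule trm_eq.meet_join)
  have jz: "x \<squnion> \<bottom> = x" for x :: D4 by transfer (rule trm_eq.join_zero)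
  have mo: "x \<sqinter> \<top> = x" for x :: D4 by transfer (rule trm_eq.meet_one)
  have mi: "x \<sqinter> x = x" for x :: D4 using mj[of x "x \<sqinter> x"] by (simp add: jm)
  have le_join: "x \<le> y \<longleftrightarrow> x \<squnion> y = y" for x y :: D4
    unfolding less_eq_D4_def by (metis jm mj jc mc)
  fix x y z :: D4
  show "x < y \<longleftrightarrow> x \<le> y \<and> \<not> y \<le> x"
    unfolding less_D4_def less_eq_D4_def by (metis mc mi)
  show "x \<le> x" by (simp add: less_eq_D4_def mi)
  show "x \<le> z" if "x \<le> y" "y \<le> z" using that unfolding less_eq_D4_def by (metis ma)
  show "x = y" if "x \<le> y" "y \<le> x" using that unfolding less_eq_D4_def by (metis mc)
  show "x \<sqinter> y \<le> x" unfolding less_eq_D4_def by (metis ma mc mi)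
  show "x \<sqinter> y \<le> y" unfolding less_eq_D4_def by (metis ma mi)
  show "x \<le> y \<sqinter> z" if "x \<le> y" "x \<le> z" using that unfolding less_eq_D4_def by (metis ma)
  show "x \<le> x \<squnion> y" by (simp add: less_eq_D4_def mj)
  show "y \<le> x \<squnion> y" unfolding less_eq_D4_def by (metis jc mj)
  show "y \<squnion> z \<le> x" if "y \<le> x" "z \<le> x" using that unfolding le_join by (metis ja)
  show "\<bottom> \<le> x" unfolding le_join by (metis jc jz)
  show "x \<le> \<top>" by (simp add: less_eq_D4_def mo)
qed

end

lift_definition gen :: "4 \<Rightarrow> D4" is Gen .

lemma D4_modular:
  fixes x y z :: D4
  assumes "x \<le> z"
  shows "(x \<squnion> y) \<sqinter> z = x \<squnion> (y \<sqinter> z)"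
proof -
  have "(x \<sqinter> z) \<squnion> (y \<sqinter> z) = ((x \<sqinter> z) \<squnion> y) \<sqinter> z" by transfer (rule trm_eq.modular)
  with assms show ?thesis by (simp add: inf_absorb1)
qed

lemma D4_induct [case_names bot top gen sup inf]:
  assumes "P \<bottom>" "P \<top>" "\<And>m. P (gen m)"
    and "\<And>x y. P x \<Longrightarrow> P y \<Longrightarrow> P (x \<squnion> y)" "\<And>x y. P x \<Longrightarrow> P y \<Longrightarrow> P (x \<sqinter> y)"
  shows "P x"
proof -
  have "P (abs_D4 u)" for u
    by (induction u)
      (use assms in \<open>simp_all add: bot_D4_def top_D4_def gen_def sup_D4.abs_eq[symmetric]
        inf_D4.abs_eq[symmetric]\<close>)
  then show ?thesis by (metis Quotient_D4 Quotient_abs_rep)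
qed

section \<open>Herrmann's endomorphisms\<close>

definition others :: "4 \<Rightarrow> 4 \<Rightarrow> 4 \<times> 4" where
  "others i j = (SOME (k, l). {i, j, k, l} = UNIV)"

lemma others:
  assumes "{i, j, k, l} = UNIV"
  shows "others i j = (k, l) \<or> others i j = (l, k)"
proof -
  obtain k' l' where o: "others i j = (k', l')" by fastforce
  have "case others i j of (k, l) \<Rightarrow> {i, j, k, l} = UNIV"
    unfolding others_def by (rule someI[of _ "(k, l)"]) (use assms in simp)
  then have *: "{i, j, k', l'} = UNIV" by (simp add: o)
  have c: "card {i, j, k, l} = 4" "card {i, j, k', l'} = 4" by (simp_all add: assms *)
  then have "k \<noteq> i" "k \<noteq> j" "l \<noteq> i" "l \<noteq> j" "k' \<noteq> i" "k' \<noteq> j" "l' \<noteq> i" "l' \<noteq> j" "k \<noteq> l" "k' \<noteq> l'"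
    by (auto simp: card_insert_if split: if_splits)
  moreover have "k' \<in> {i, j, k, l}" "l' \<in> {i, j, k, l}" by (simp_all add: assms)
  ultimately show ?thesis by (auto simp: o)
qed

definition q :: "4 \<Rightarrow> 4 \<Rightarrow> D4" where
  "q i j = (let (k, l) = others i j in (gen i \<squnion> gen j) \<sqinter> (gen k \<squnion> gen l))"

lemma q_eq: "{i, j, k, l} = UNIV \<Longrightarrow> q i j = (gen i \<squnion> gen j) \<sqinter> (gen k \<squnion> gen l)"
  using others[of i j k l] by (auto simp: q_def sup_commute)

text \<open>Value of a term in the interval between \<open>\<bottom>\<close> and \<open>u\<close>, with \<open>u\<close> in the role of \<open>I\<close>.\<close>

primrec trm_val :: "D4 \<Rightarrow> (4 \<Rightarrow> D4) \<Rightarrow> trm \<Rightarrow> D4" where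
  "trm_val u g Zero = \<bottom>"
| "trm_val u g One = u"
| "trm_val u g (Gen m) = g m"
| "trm_val u g (Join x y) = trm_val u g x \<squnion> trm_val u g y"
| "trm_val u g (Meet x y) = trm_val u g x \<sqinter> trm_val u g y"

lemma trm_val_le: "(\<And>m. g m \<le> u) \<Longrightarrow> trm_val u g x \<le> u"
  by (induction x) (auto intro: le_infI1)

lemma trm_val_cong:
  assumes g: "\<And>m. g m \<le> u" and "trm_eq x y"
  shows "trm_val u g x = trm_val u g y"
  using assms(2)
proof (induction rule: trm_eq.induct)
  case (modular x z y)
  show ?case
    using D4_modular[of "trm_val u g x \<sqinter> trm_val u g z" "trm_val u g z" "trm_val u g y"] by simp
qed (simp_all add: ac_simps sup_inf_absorb inf_sup_absorb inf.absorb2 trm_val_le[of g u, OF g])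

text \<open>\<open>\<gamma>_simps\<close> and \<open>\<gamma>_unique\<close> below: \<open>\<gamma> i j\<close> is the only endomorphism with the prescribed values.\<close>

lift_definition \<gamma> :: "4 \<Rightarrow> 4 \<Rightarrow> D4 \<Rightarrow> D4" is
  "\<lambda>i j. trm_val (q i j) (\<lambda>m. gen m \<sqinter> q i j)"
  by (rule trm_val_cong) simp_all

lemma \<gamma>_simps [simp]:
  "\<gamma> i j \<bottom> = \<bottom>"
  "\<gamma> i j \<top> = q i j"
  "\<gamma> i j (gen m) = gen m \<sqinter> q i j"
  "\<gamma> i j (x \<squnion> y) = \<gamma> i j x \<squnion> \<gamma> i j y"
  "\<gamma> i j (x \<sqinter> y) = \<gamma> i j x \<sqinter> \<gamma> i j y"
  subgoal by transfer simp
  subgoal by transfer simp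
  subgoal by transfer simp
  subgoal by transfer simp
  subgoal by transfer simp
  done

lemma \<gamma>_unique:
  assumes "h \<bottom> = \<bottom>" "h \<top> = q i j" "\<And>m. h (gen m) = gen m \<sqinter> q i j"
    and "\<And>x y. h (x \<squnion> y) = h x \<squnion> h y" "\<And>x y. h (x \<sqinter> y) = h x \<sqinter> h y"
  shows "h = \<gamma> i j"
proof
  fix x show "h x = \<gamma> i j x" by (induction x rule: D4_induct) (simp_all add: assms)
qed

section \<open>Atomic elements\<close>

fun atomic :: "4 \<Rightarrow> 4 \<Rightarrow> nat \<Rightarrow> D4" where
  "atomic i j 0 = \<top>"
| "atomic i j (Suc n) = (let (k, l) = others i j in gen i \<squnion> gen j \<sqinter> atomic k l n)"

lemma perm_UNIV:
  assumes "{i, j, k, l} = (UNIV :: 4 set)"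
  shows "{k, l, i, j} = UNIV" "{l, k, j, i} = UNIV" "{j, i, k, l} = UNIV" "{i, j, l, k} = UNIV"
    "{l, k, i, j} = UNIV"
  using assms by (simp_all add: insert_commute)

text \<open>The choice of the order of \<open>k\<close> and \<open>l\<close> in the recursion is immaterial.\<close>

lemma gen_inf_atomic_commute:
  "{i, j, k, l} = UNIV \<Longrightarrow> gen j \<sqinter> atomic k l n = gen j \<sqinter> atomic l k n"
proof (induction n arbitrary: i j k l)
  case (Suc n)
  note U = Suc.prems perm_UNIV[OF Suc.prems]
  have 1: "gen l \<sqinter> atomic i j n = gen l \<sqinter> atomic j i n" using Suc.IH[of k l i j] U by blast
  have 2: "gen k \<sqinter> atomic i j n = gen k \<sqinter> atomic j i n" using Suc.IH[of l k i j] U by blast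
  have kl: "atomic k l (Suc n) = gen k \<squnion> gen l \<sqinter> atomic j i n"
    using others[OF U(2)] 1 by auto
  have lk: "atomic l k (Suc n) = gen l \<squnion> gen k \<sqinter> atomic j i n"
    using others[OF U(6)] 2 by auto
  define b where "b = atomic j i n"
  have jb: "gen j \<le> b"
    by (cases n) (auto simp: b_def split: prod.splits)
  have "gen j \<sqinter> (gen k \<squnion> gen l \<sqinter> b) = gen j \<sqinter> ((gen l \<sqinter> b \<squnion> gen k) \<sqinter> b)"
    using jb by (metis inf.absorb1 inf.assoc inf.commute sup.commute)
  also have "\<dots> = gen j \<sqinter> ((gen k \<sqinter> b \<squnion> gen l) \<sqinter> b)"
    using D4_modular[of "gen l \<sqinter> b" b "gen k"] D4_modular[of "gen k \<sqinter> b" b "gen l"]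
    by (simp add: sup_commute)
  also have "\<dots> = gen j \<sqinter> (gen l \<squnion> gen k \<sqinter> b)"
    using jb by (metis inf.absorb1 inf.assoc inf.commute sup.commute)
  finally show ?case by (simp only: kl lk b_def)
qed simp

lemma atomic_Suc:
  "{i, j, k, l} = UNIV \<Longrightarrow> atomic i j (Suc n) = gen i \<squnion> gen j \<sqinter> atomic k l n"
  using others[of i j k l] gen_inf_atomic_commute[of i j k l n] by auto

section \<open>Admissible sequences and admissible elements\<close>

text \<open>The sequence \<open>i\<^sub>n \<dots> i\<^sub>1\<close> is the list \<open>[i\<^sub>n, \<dots>, i\<^sub>1]\<close>: it starts at \<^term>\<open>last \<alpha>\<close> and ends at
  \<^term>\<open>hd \<alpha>\<close>.\<close>

definition admissible :: "4 list \<Rightarrow> bool" where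
  "admissible \<alpha> \<longleftrightarrow> \<alpha> \<noteq> [] \<and> distinct_adj \<alpha>"

inductive replacement :: "4 list \<Rightarrow> 4 list \<Rightarrow> bool" where
  "{i, j, k, l} = UNIV \<Longrightarrow> replacement (us @ [i, j, l] @ vs) (us @ [i, k, l] @ vs)"

abbreviation identified :: "4 list \<Rightarrow> 4 list \<Rightarrow> bool" where
  "identified \<equiv> replacement\<^sup>*\<^sup>*"

definition rep :: "4 list \<Rightarrow> nat \<Rightarrow> 4 list" where
  "rep w n = concat (replicate n w)"

text \<open>\<open>adm_table p \<beta> x y\<close>: for the sequence \<open>\<beta>\<close> starting at \<open>1\<close>, with all indices permuted by \<open>p\<close>, the
  expressions \<open>x\<close> and \<open>y\<close> stand for \<open>e\<^sub>\<alpha>\<close> and \<open>f\<^sub>\<alpha>\<^sub>0\<close>.  The side conditions keep lower indices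
  non-negative.  Up to identification the eight types cover all sequences starting at \<open>1\<close>; for example
  \<open>2(31)\<^sup>s(21)\<^sup>t\<close> is identified with \<open>2(41)(31)\<^sup>s\<^sup>-\<^sup>1(21)\<^sup>t\<close>, so \<open>2(41)\<^sup>r(31)\<^sup>s(21)\<^sup>t\<close> is only needed
  for \<open>r \<ge> 1\<close>; likewise \<open>(14)\<^sup>r(31)\<^sup>s(21)\<^sup>t\<close> is only needed for \<open>s \<ge> 1\<close>.

  Pitfall: in the last four types the order of the blocks matters.  The elements
  \<open>e\<^sub>2 a\<^sup>3\<^sup>4\<^sub>2\<^sub>t a\<^sup>3\<^sup>1\<^sub>2\<^sub>s\<^sub>+\<^sub>1 a\<^sup>1\<^sup>4\<^sub>2\<^sub>r\<^sub>-\<^sub>1\<close> and \<open>e\<^sub>2 a\<^sup>3\<^sup>4\<^sub>2\<^sub>t a\<^sup>3\<^sup>1\<^sub>2\<^sub>s\<^sub>-\<^sub>1 a\<^sup>1\<^sup>4\<^sub>2\<^sub>r\<^sub>+\<^sub>1\<close> are sometimes equated, but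
  they differ already in a plane (\<open>r = s = 1\<close>, \<open>t = 0\<close>, with \<open>e\<^sub>2 = e\<^sub>3\<close> and \<open>e\<^sub>1, e\<^sub>2, e\<^sub>4\<close> distinct
  lines).  The second one belongs to \<open>2(31)\<^sup>s(41)\<^sup>r(21)\<^sup>t\<close>, which is not identified with
  \<open>2(41)\<^sup>r(31)\<^sup>s(21)\<^sup>t\<close>.  The table has the expressions that fit the order of the blocks in \<open>\<beta>\<close>.  For
  the types \<open>2\<dots>\<close>, \<open>3\<dots>\<close>, \<open>4\<dots>\<close> this also fixes the lower indices in the second expression for \<open>f\<^sub>\<alpha>\<^sub>0\<close>:
  \<open>e\<^sub>3 a\<^sup>2\<^sup>1\<^sub>2\<^sub>t a\<^sup>2\<^sup>4\<^sub>2\<^sub>s\<^sub>+\<^sub>1\<close>, not \<open>e\<^sub>3 a\<^sup>2\<^sup>1\<^sub>2\<^sub>s\<^sub>+\<^sub>1 a\<^sup>2\<^sup>4\<^sub>2\<^sub>t\<close>.\<close>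

context
  fixes p :: "4 \<Rightarrow> 4"
begin

private abbreviation E :: "4 \<Rightarrow> D4" where "E i \<equiv> gen (p i)"
private abbreviation A :: "4 \<Rightarrow> 4 \<Rightarrow> nat \<Rightarrow> D4" where "A i j n \<equiv> atomic (p i) (p j) n"

inductive adm_table :: "4 list \<Rightarrow> D4 \<Rightarrow> D4 \<Rightarrow> bool" where
  type_21_41_31:
  "\<lbrakk>t \<ge> 1; x = E 2 \<sqinter> A 3 1 (2*s) \<sqinter> A 4 1 (2*r) \<sqinter> A 3 4 (2*t-1);
    s \<ge> 1 \<and> y = x \<sqinter> (E 2 \<sqinter> A 3 4 (2*t) \<squnion> A 4 1 (2*r+1) \<sqinter> A 3 1 (2*s-1)) \<or>
    y = x \<sqinter> (A 4 3 (2*t) \<squnion> E 1 \<sqinter> A 2 4 (2*r) \<sqinter> A 2 3 (2*s))\<rbrakk>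
   \<Longrightarrow> adm_table (rep [2,1] t @ rep [4,1] r @ rep [3,1] s) x y"
| type_31_41_21:
  "\<lbrakk>s \<ge> 1; x = E 3 \<sqinter> A 2 1 (2*t) \<sqinter> A 4 1 (2*r) \<sqinter> A 2 4 (2*s-1);
    t \<ge> 1 \<and> y = x \<sqinter> (E 3 \<sqinter> A 4 2 (2*s) \<squnion> A 4 1 (2*r+1) \<sqinter> A 2 1 (2*t-1)) \<or>
    y = x \<sqinter> (A 4 2 (2*s) \<squnion> E 1 \<sqinter> A 3 4 (2*r) \<sqinter> A 3 2 (2*t))\<rbrakk>
   \<Longrightarrow> adm_table (rep [3,1] s @ rep [4,1] r @ rep [2,1] t) x y"
| type_41_31_21:
  "\<lbrakk>r \<ge> 1; x = E 4 \<sqinter> A 2 1 (2*t) \<sqinter> A 3 1 (2*s) \<sqinter> A 3 2 (2*r-1);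
    t \<ge> 1 \<and> y = x \<sqinter> (E 4 \<sqinter> A 3 2 (2*r) \<squnion> A 3 1 (2*s+1) \<sqinter> A 2 1 (2*t-1)) \<or>
    y = x \<sqinter> (A 3 2 (2*r) \<squnion> E 1 \<sqinter> A 4 3 (2*s) \<sqinter> A 4 2 (2*t))\<rbrakk>
   \<Longrightarrow> adm_table (rep [4,1] r @ rep [3,1] s @ rep [2,1] t) x y"
| type_1_41_31_21:
  "\<lbrakk>x = E 1 \<sqinter> A 2 4 (2*s) \<sqinter> A 3 4 (2*t) \<sqinter> A 3 2 (2*r);
    t \<ge> 1 \<and> y = x \<sqinter> (E 1 \<sqinter> A 3 2 (2*r+1) \<squnion> A 2 4 (2*s+1) \<sqinter> A 3 4 (2*t-1)) \<or>
    y = x \<sqinter> (A 3 2 (2*r+1) \<squnion> E 4 \<sqinter> A 2 1 (2*s) \<sqinter> A 3 1 (2*t))\<rbrakk>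
   \<Longrightarrow> adm_table ([1] @ rep [4,1] r @ rep [3,1] s @ rep [2,1] t) x y"
| type_2_41_31_21:
  "\<lbrakk>r \<ge> 1; x = E 2 \<sqinter> A 3 4 (2*t) \<sqinter> A 3 1 (2*s+1) \<sqinter> A 1 4 (2*r-1);
    t \<ge> 1 \<and> y = x \<sqinter> (E 2 \<sqinter> A 1 4 (2*r) \<squnion> A 3 1 (2*s+2) \<sqinter> A 3 4 (2*t-1)) \<or>
    y = x \<sqinter> (A 1 4 (2*r) \<squnion> E 3 \<sqinter> A 2 1 (2*t) \<sqinter> A 2 4 (2*s+1))\<rbrakk>
   \<Longrightarrow> adm_table ([2] @ rep [4,1] r @ rep [3,1] s @ rep [2,1] t) x y"
| type_3_41_21_31:
  "\<lbrakk>r \<ge> 1; x = E 3 \<sqinter> A 2 4 (2*s) \<sqinter> A 2 1 (2*t+1) \<sqinter> A 1 4 (2*r-1);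
    s \<ge> 1 \<and> y = x \<sqinter> (E 3 \<sqinter> A 1 4 (2*r) \<squnion> A 2 1 (2*t+2) \<sqinter> A 2 4 (2*s-1)) \<or>
    y = x \<sqinter> (A 1 4 (2*r) \<squnion> E 2 \<sqinter> A 3 1 (2*s) \<sqinter> A 3 4 (2*t+1))\<rbrakk>
   \<Longrightarrow> adm_table ([3] @ rep [4,1] r @ rep [2,1] t @ rep [3,1] s) x y"
| type_4_21_31_41:
  "\<lbrakk>t \<ge> 1; x = E 4 \<sqinter> A 3 2 (2*r) \<sqinter> A 3 1 (2*s+1) \<sqinter> A 1 2 (2*t-1);
    y = x \<sqinter> (E 4 \<sqinter> A 1 2 (2*t) \<squnion> A 3 1 (2*s) \<sqinter> A 3 2 (2*r+1)) \<or>
    y = x \<sqinter> (A 1 2 (2*t) \<squnion> E 3 \<sqinter> A 4 1 (2*r) \<sqinter> A 4 2 (2*s+1))\<rbrakk>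
   \<Longrightarrow> adm_table ([4] @ rep [2,1] t @ rep [3,1] s @ rep [4,1] r) x y"
| type_14_31_21:
  "\<lbrakk>r \<ge> 1; s \<ge> 1; x = E 1 \<sqinter> A 2 3 (2*r-1) \<sqinter> A 2 4 (2*s-1) \<sqinter> A 3 4 (2*t+1);
    y = x \<sqinter> (E 1 \<sqinter> A 2 3 (2*r) \<squnion> A 2 4 (2*s) \<sqinter> A 3 4 (2*t)) \<or>
    y = x \<sqinter> (E 1 \<sqinter> A 2 4 (2*s) \<squnion> A 3 4 (2*t) \<sqinter> A 2 3 (2*r))\<rbrakk>
   \<Longrightarrow> adm_table (rep [1,4] r @ rep [3,1] s @ rep [2,1] t) x y"

end

text \<open>For a sequence starting at \<open>m\<close> the indices \<open>1\<close> and \<open>m\<close> are interchanged everywhere.\<close>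

definition adm_expr :: "4 list \<Rightarrow> D4 \<Rightarrow> D4 \<Rightarrow> bool" where
  "adm_expr \<alpha> x y \<longleftrightarrow>
    (\<exists>m \<beta>. identified \<alpha> (map (transpose 1 m) \<beta>) \<and> adm_table (transpose 1 m) \<beta> x y)"

definition adm_e :: "4 list \<Rightarrow> D4" where
  "adm_e \<alpha> = (THE x. \<exists>y. adm_expr \<alpha> x y)"

definition adm_f :: "4 list \<Rightarrow> D4" where
  "adm_f \<alpha> = (THE y. \<exists>x. adm_expr \<alpha> x y)"

end

theory Submission
  imports Defs "HOL-Library.Multiset"
begin

text \<open>
  Let \<open>\<phi>\<close> be a composite of Herrmann's endomorphisms in which the three splits \<open>{i, j | k, l}\<close>,
  \<open>{i, k | j, l}\<close>, \<open>{i, l | j, k}\<close> of the index set occur \<open>t\<close>, \<open>s\<close>, \<open>r\<close> times.  Two facts describe \<open>\<phi>\<close>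
  on everything that matters.  First, \<open>\<phi> (gen i) = gen i \<sqinter> \<phi> \<top>\<close>.  Second, \<open>\<phi>\<close> maps an atomic element
  to its meet with \<open>\<phi> \<top>\<close>, after its lower index has been raised by the number of occurrences of its
  split (\<open>\<gamma>_atomic\<close>, \<open>composite_atomic\<close>).  From these, \<open>\<phi> (gen i)\<close> is the meet of \<open>gen i\<close> with the
  atomic elements \<open>atomic k l t\<close>, \<open>atomic j l s\<close>, \<open>atomic j k r\<close> (\<open>composite_gen_value\<close>).  The element
  \<open>f\<^sub>i\<^sub>0 = e\<^sub>i (e\<^sub>j + e\<^sub>k + e\<^sub>l)\<close> is an expression in generators and in \<open>e\<^sub>k + e\<^sub>l = a\<^sup>k\<^sup>l\<^sub>1\<close>, so its image can be
  read off as well, in several ways that are equal by the modular law (\<open>composite_f_zero_partner\<close>,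
  \<open>composite_f_zero_sum\<close>, \<open>composite_f_zero_swapped\<close>).  This gives the displayed formulas.

  For the description of all admissible elements, each step between neighbours of an admissible
  sequence is labelled with the split of the two indices.  Identified sequences have the same end and
  the same multiset of steps, and conversely these data determine the class, because a replacement
  interchanges two consecutive steps (\<open>identified_invariants\<close>, \<open>identified_if_hd_steps\<close>).  Every end
  and every triple of multiplicities occurs (\<open>steps_surj\<close>).  It remains to compare with the table of
  admissible elements: its lower indices are the multiplicities of the steps, so that \<open>e\<^sub>\<alpha>\<close> and \<open>f\<^sub>\<alpha>\<^sub>0\<close> are
  the images of \<open>e\<^sub>i\<close> and \<open>f\<^sub>i\<^sub>0\<close>, with \<open>i\<close> the end of \<open>\<alpha>\<close>, under the composite with these multiplicities
  (\<open>table_values\<close>), and the parities of the multiplicities select the type (\<open>table_exists\<close>).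
\<close>

section \<open>Pairings of the index set\<close>

text \<open>The recursion equation contains the arbitrary choice made by \<^const>\<open>others\<close>; atomic elements are
  only unfolded by \<open>atomic_Suc\<close>.\<close>

declare atomic.simps(2) [simp del]

text \<open>The two pairs \<open>{i, j}\<close> and \<open>{k, l}\<close> into which four indices are split give the same \<open>q i j\<close> and
  the same endomorphism \<open>\<gamma> i j\<close>, so these are labelled by the split itself.\<close>

definition pairing :: "4 \<Rightarrow> 4 \<Rightarrow> 4 set set" where
  "pairing i j = {{i, j}, - {i, j}}"

lemma UNIV_distinct:
  assumes "{i, j, k, l} = (UNIV :: 4 set)"
  shows "distinct [i, j, k, l]"
proof -
  have "card {i, j, k, l} = 4" by (simp add: assms)
  then show ?thesis by (auto simp: card_insert_if split: if_splits)
qed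

lemma card_Compl_pair: "(i::4) \<noteq> j \<Longrightarrow> card (- {i, j}) = 2"
  by (simp add: Compl_eq_Diff_UNIV card_Diff_subset)

lemma other_indices:
  assumes "(i::4) \<noteq> j"
  obtains k l where "{i, j, k, l} = UNIV"
proof -
  have "card (- {i, j}) = 2"
    by (rule card_Compl_pair[OF assms])
  then obtain k l where "- {i, j} = {k, l}" by (auto simp: card_2_iff)
  then have "{i, j, k, l} = UNIV" by auto
  then show ?thesis by (rule that)
qed

lemma fourth_index:
  assumes "distinct [i, j, k :: 4]"
  obtains l where "{i, j, k, l} = UNIV"
proof -
  obtain a b where ab: "{i, j, a, b} = UNIV" using assms other_indices[of i j] by auto
  then have "k = a \<or> k = b" using assms by auto
  then show ?thesis using ab that[of a] that[of b] by (auto simp: insert_commute)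
qed

lemma pairing_sym: "pairing i j = pairing j i"
  by (simp add: pairing_def insert_commute)

lemma Compl_pair:
  assumes "{i, j, k, l} = (UNIV :: 4 set)"
  shows "- {i, j} = {k, l}"
  using assms UNIV_distinct[OF assms] by auto

lemma pairing_complement:
  assumes "{i, j, k, l} = UNIV"
  shows "pairing k l = pairing i j"
  using Compl_pair[OF assms] by (metis pairing_def double_complement insert_commute)

lemma pairing_inject:
  assumes "j \<noteq> i" "pairing i j = pairing i k"
  shows "j = k"
proof -
  have "{i, j} \<in> pairing i k" using assms(2)[symmetric] by (simp add: pairing_def)
  then show ?thesis using assms(1) by (auto simp: pairing_def doubleton_eq_iff)
qed

lemma pairing_refl_neq:
  assumes "i \<noteq> j"
  shows "pairing x x \<noteq> pairing i j"
proof
  assume "pairing x x = pairing i j"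
  then have "{x} = {i, j} \<or> {x} = - {i, j}" by (auto simp: pairing_def)
  moreover have "card {x} = 1" "card {i, j} = 2" "card (- {i, j}) = 2"
    using assms card_Compl_pair by simp_all
  ultimately show False by (metis One_nat_def Suc_1 n_not_Suc_n)
qed

lemma pairing_cases:
  assumes "{i, j, k, l} = UNIV" "x \<noteq> y"
  shows "pairing x y = pairing i j \<or> pairing x y = pairing i k \<or> pairing x y = pairing i l"
proof -
  have c: "pairing k l = pairing i j" "pairing j l = pairing i k" "pairing j k = pairing i l"
    using assms(1) by (auto intro!: pairing_complement simp: insert_commute)
  have "x \<in> {i, j, k, l}" "y \<in> {i, j, k, l}" using assms(1) by auto
  then show ?thesis using assms(2) c pairing_sym by (smt (verit) empty_iff insert_iff)
qed

lemma pairings_of: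
  assumes "{i, j, k, l} = UNIV"
  shows "pairing k l = pairing i j" "pairing j l = pairing i k" "pairing j k = pairing i l"
    "pairing i j \<noteq> pairing i k" "pairing i j \<noteq> pairing i l" "pairing i k \<noteq> pairing i l"
proof -
  show "pairing k l = pairing i j" "pairing j l = pairing i k" "pairing j k = pairing i l"
    using assms by (auto intro!: pairing_complement simp: insert_commute)
  show "pairing i j \<noteq> pairing i k" "pairing i j \<noteq> pairing i l" "pairing i k \<noteq> pairing i l"
    using UNIV_distinct[OF assms] pairing_inject[of j i] pairing_inject[of k i] by auto
qed

lemma pairings_canonical:
  assumes "{a, b, c, d} = UNIV"
  shows "pairing b a = pairing a b" "pairing c d = pairing a b" "pairing d c = pairing a b"
    "pairing c a = pairing a c" "pairing b d = pairing a c" "pairing d b = pairing a c"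
    "pairing d a = pairing a d" "pairing b c = pairing a d" "pairing c b = pairing a d"
  using pairings_of[OF assms] pairing_sym by metis+

lemma q_pairing:
  assumes "i \<noteq> j" "x \<noteq> y" "pairing i j = pairing x y"
  shows "q i j = q x y"
proof -
  obtain k l where U: "{i, j, k, l} = UNIV" using other_indices[OF assms(1)] .
  have "{x, y} \<in> pairing i j" using assms(3) by (simp add: pairing_def)
  then consider "{x, y} = {i, j}" | "{x, y} = {k, l}"
    using Compl_pair[OF U] by (auto simp: pairing_def)
  then show ?thesis
  proof cases
    case 1
    have "{x, y, k, l} = UNIV" using 1 U by (metis insert_is_Un Un_assoc)
    then show ?thesis using 1 U q_eq by (metis doubleton_eq_iff sup_commute)
  next
    case 2
    have "{x, y, i, j} = UNIV" using 2 U by (metis insert_is_Un Un_assoc Un_commute)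
    then show ?thesis using 2 U q_eq by (metis doubleton_eq_iff sup_commute inf_commute)
  qed
qed

lemma \<gamma>_pairing:
  assumes "i \<noteq> j" "x \<noteq> y" "pairing i j = pairing x y"
  shows "\<gamma> i j = \<gamma> x y"
  by (rule \<gamma>_unique) (simp_all add: q_pairing[OF assms])

section \<open>Multisets of pairings\<close>

text \<open>The pair \<open>i i\<close> also has a value under \<^const>\<open>pairing\<close>, one that is never the split of two
  different indices; this is what makes admissibility of a sequence visible in its steps.\<close>

definition proper :: "4 set set multiset \<Rightarrow> bool" where
  "proper M \<longleftrightarrow> (\<forall>P\<in>#M. \<exists>x y. x \<noteq> y \<and> P = pairing x y)"

definition pairing_mset :: "4 \<Rightarrow> 4 \<Rightarrow> 4 \<Rightarrow> 4 \<Rightarrow> nat \<Rightarrow> nat \<Rightarrow> nat \<Rightarrow> 4 set set multiset" where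
  "pairing_mset a b c d u v w = replicate_mset u (pairing a b) + replicate_mset v (pairing a c) + replicate_mset w (pairing a d)"

lemma count_pairing_mset:
  assumes "{a, b, c, d} = UNIV"
  shows "count (pairing_mset a b c d u v w) (pairing a b) = u" "count (pairing_mset a b c d u v w) (pairing a c) = v"
    "count (pairing_mset a b c d u v w) (pairing a d) = w"
  using pairings_of[OF assms] by (auto simp: pairing_mset_def)

lemma pairing_mset_permute:
  "pairing_mset a c b d u v w = pairing_mset a b c d v u w"
  "pairing_mset a d c b u v w = pairing_mset a b c d w v u"
  "pairing_mset a b d c u v w = pairing_mset a b c d u w v"
  "pairing_mset a d b c u v w = pairing_mset a b c d v w u"
  by (simp_all add: pairing_mset_def ac_simps)

lemma proper_eq_pairing_mset:
  assumes U: "{a, b, c, d} = UNIV" and M: "proper M"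
  shows "M = pairing_mset a b c d (count M (pairing a b)) (count M (pairing a c)) (count M (pairing a d))" (is "_ = ?W")
proof (rule multiset_eqI)
  fix P
  show "count M P = count ?W P"
  proof (cases "P \<in> {pairing a b, pairing a c, pairing a d}")
    case True
    then show ?thesis using count_pairing_mset[OF U] by auto
  next
    case False
    then have "P \<notin># M" using M pairing_cases[OF U] by (metis insert_iff proper_def)
    then show ?thesis using False by (auto simp: pairing_mset_def not_in_iff)
  qed
qed

section \<open>Herrmann's endomorphisms on atomic elements\<close>

lemma atomic_le_sup:
  assumes "{i, j, k, l} = UNIV"
  shows "atomic i j (Suc n) \<le> gen i \<squnion> gen j"
  by (simp only: atomic_Suc[OF assms]) (meson inf_le1 sup.mono order_refl)

lemma atomic_decreasing: "i \<noteq> j \<Longrightarrow> atomic i j (Suc n) \<le> atomic i j n"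
proof (induction n arbitrary: i j)
  case (Suc n)
  obtain k l where U: "{i, j, k, l} = UNIV" using other_indices[OF Suc.prems] .
  have "k \<noteq> l" using UNIV_distinct[OF U] by simp
  then show ?case
    unfolding atomic_Suc[OF U] by (intro sup_mono inf_mono order_refl Suc.IH)
qed simp

text \<open>An endomorphism cuts an atomic element down to the interval below \<open>q i j\<close>.  If the atomic element
  belongs to the same split, its lower index also goes up by one: each of the nested generators
  acquires the factor \<open>gen k \<squnion> gen l\<close> or \<open>gen i \<squnion> gen j\<close>, these factors move outwards by the modular
  law, and only the innermost one, which replaces \<open>\<top>\<close>, is new.\<close>

lemma \<gamma>_atomic_same:
  "{i, j, k, l} = UNIV \<Longrightarrow> \<gamma> i j (atomic i j n) = q i j \<sqinter> atomic i j (Suc n)"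
proof (induction n arbitrary: i j k l)
  case 0
  have "q i j \<le> gen i \<squnion> gen j" unfolding q_eq[OF 0] by simp
  moreover have "atomic i j (Suc 0) = gen i \<squnion> gen j" using atomic_Suc[OF 0, of 0] by simp
  ultimately show ?case by (simp add: inf_absorb1)
next
  case (Suc n)
  have V: "{k, l, i, j} = UNIV" using Suc.prems by (simp add: insert_commute)
  have d: "distinct [i, j, k, l]" by (rule UNIV_distinct[OF Suc.prems])
  have p: "pairing i j = pairing k l" by (rule pairing_complement[OF V])
  have Q: "q i j = (gen i \<squnion> gen j) \<sqinter> (gen k \<squnion> gen l)" by (rule q_eq[OF Suc.prems])
  let ?B = "atomic k l (Suc n)"
  have B: "?B \<le> gen k \<squnion> gen l" by (rule atomic_le_sup[OF V])
  have "\<gamma> i j (atomic k l n) = q i j \<sqinter> ?B"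
    using Suc.IH[OF V] \<gamma>_pairing[OF _ _ p] q_pairing[OF _ _ p] d by simp
  then have "\<gamma> i j (atomic i j (Suc n)) = gen i \<sqinter> q i j \<squnion> gen j \<sqinter> q i j \<sqinter> (q i j \<sqinter> ?B)"
    unfolding atomic_Suc[OF Suc.prems] by simp
  also have "gen i \<sqinter> q i j = gen i \<sqinter> (gen k \<squnion> gen l)"
    unfolding Q by (simp add: inf_sup_absorb flip: inf_assoc)
  also have "gen j \<sqinter> q i j \<sqinter> (q i j \<sqinter> ?B) = gen j \<sqinter> ?B"
    unfolding Q by (intro antisym le_infI inf_le1 inf_le2)
      (auto intro: le_infI1 le_infI2 order_trans[OF B])
  also have "gen i \<sqinter> (gen k \<squnion> gen l) \<squnion> gen j \<sqinter> ?B = (gen i \<squnion> gen j \<sqinter> ?B) \<sqinter> (gen k \<squnion> gen l)"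
    using D4_modular[of "gen j \<sqinter> ?B" "gen k \<squnion> gen l" "gen i"] B
    by (simp add: le_infI2 sup_commute)
  also have "gen i \<squnion> gen j \<sqinter> ?B = (gen i \<squnion> gen j) \<sqinter> atomic i j (Suc (Suc n))"
    using atomic_le_sup[OF Suc.prems, of "Suc n"] atomic_Suc[OF Suc.prems, of "Suc n"]
    by (simp add: inf_absorb2)
  also have "\<dots> \<sqinter> (gen k \<squnion> gen l) = q i j \<sqinter> atomic i j (Suc (Suc n))"
    unfolding Q by (simp add: inf_commute inf_left_commute)
  finally show ?case .
qed

text \<open>Here, too, the factors acquired by the generators move outwards by the modular law, but none of
  them stays inside: together they form \<open>q i j\<close>.\<close>

lemma \<gamma>_atomic_other:
  "{i, j, k, l} = UNIV \<Longrightarrow> \<gamma> i j (atomic i k n) = q i j \<sqinter> atomic i k n"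
proof (induction n arbitrary: i j k l)
  case 0
  then show ?case by simp
next
  case (Suc n)
  have V: "{j, i, l, k} = UNIV" "{i, k, j, l} = UNIV" using Suc.prems by (simp_all add: insert_commute)
  have d: "distinct [i, j, k, l]" by (rule UNIV_distinct[OF Suc.prems])
  have Q: "q i j = (gen i \<squnion> gen j) \<sqinter> (gen k \<squnion> gen l)" by (rule q_eq[OF Suc.prems])
  let ?B = "atomic j l n"
  have "\<gamma> i j ?B = q i j \<sqinter> ?B"
    using Suc.IH[OF V(1)] \<gamma>_pairing[of i j j i] q_pairing[of i j j i] d pairing_sym[of i j] by fastforce
  then have "\<gamma> i j (atomic i k (Suc n)) = gen i \<sqinter> q i j \<squnion> gen k \<sqinter> q i j \<sqinter> (q i j \<sqinter> ?B)"
    unfolding atomic_Suc[OF V(2)] by simp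
  also have "gen i \<sqinter> q i j = gen i \<sqinter> (gen k \<squnion> gen l)"
    unfolding Q by (simp add: inf_sup_absorb flip: inf_assoc)
  also have "gen k \<sqinter> q i j \<sqinter> (q i j \<sqinter> ?B) = gen k \<sqinter> ?B \<sqinter> (gen i \<squnion> gen j)"
    unfolding Q by (intro antisym le_infI inf_le1 inf_le2)
      (auto intro: le_infI1 le_infI2 le_supI1)
  also have "gen i \<sqinter> (gen k \<squnion> gen l) \<squnion> gen k \<sqinter> ?B \<sqinter> (gen i \<squnion> gen j) =
      (gen i \<squnion> gen k \<sqinter> ?B \<sqinter> (gen i \<squnion> gen j)) \<sqinter> (gen k \<squnion> gen l)"
    using D4_modular[of "gen k \<sqinter> ?B \<sqinter> (gen i \<squnion> gen j)" "gen k \<squnion> gen l" "gen i"]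
    by (simp add: le_infI1 le_supI1 sup_commute)
  also have "gen i \<squnion> gen k \<sqinter> ?B \<sqinter> (gen i \<squnion> gen j) = (gen i \<squnion> gen k \<sqinter> ?B) \<sqinter> (gen i \<squnion> gen j)"
    using D4_modular[of "gen i" "gen i \<squnion> gen j" "gen k \<sqinter> ?B"] by simp
  also have "\<dots> \<sqinter> (gen k \<squnion> gen l) = q i j \<sqinter> atomic i k (Suc n)"
    unfolding atomic_Suc[OF V(2)] Q by (simp add: inf_commute inf_left_commute)
  finally show ?case .
qed

lemma \<gamma>_atomic:
  assumes "a \<noteq> b" "x \<noteq> y"
  shows "\<gamma> x y (atomic a b n) = q x y \<sqinter> atomic a b (if pairing a b = pairing x y then Suc n else n)"
proof -
  obtain c d where U: "{a, b, c, d} = UNIV" using other_indices[OF assms(1)] .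
  have V: "{a, c, b, d} = UNIV" "{a, d, b, c} = UNIV" using U by (simp_all add: insert_commute)
  have D: "distinct [a, b, c, d]" by (rule UNIV_distinct[OF U])
  have ne: "pairing a b \<noteq> pairing a c" "pairing a b \<noteq> pairing a d"
    using D pairing_inject[of b a] by auto
  have use: "\<gamma> x y = \<gamma> a z \<and> q x y = q a z" if "pairing x y = pairing a z" "a \<noteq> z" for z
    using \<gamma>_pairing q_pairing assms that by blast
  consider "pairing x y = pairing a b" | "pairing x y = pairing a c" | "pairing x y = pairing a d"
    using pairing_cases[OF U assms(2)] by blast
  then show ?thesis
  proof cases
    case 1
    then show ?thesis using use[of b] assms \<gamma>_atomic_same[OF U] by simp
  next
    case 2
    then show ?thesis using use[of c] D ne \<gamma>_atomic_other[OF V(1)] by simp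
  next
    case 3
    then show ?thesis using use[of d] D ne \<gamma>_atomic_other[OF V(2)] by simp
  qed
qed

section \<open>Composites of Herrmann's endomorphisms\<close>

text \<open>A composite of endomorphisms is tracked by the multiset of the splits involved.  Its values on
  generators, atomic elements and \<open>f\<^sub>i\<^sub>0\<close> turn out to depend on this multiset only.\<close>

inductive composite :: "4 set set multiset \<Rightarrow> (D4 \<Rightarrow> D4) \<Rightarrow> bool" where
  composite_id: "composite {#} id"
| composite_step: "composite M \<phi> \<Longrightarrow> x \<noteq> y \<Longrightarrow> composite (add_mset (pairing x y) M) (\<phi> \<circ> \<gamma> x y)"

lemma composite_comp:
  assumes "composite N \<psi>" "composite M \<phi>"
  shows "composite (M + N) (\<phi> \<circ> \<psi>)"
  using assms(1)
proof (induction rule: composite.induct)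
  case (composite_step N \<psi> x y)
  then have "composite (add_mset (pairing x y) (M + N)) (\<phi> \<circ> \<psi> \<circ> \<gamma> x y)"
    by (intro composite.composite_step)
  then show ?case by (simp only: comp_assoc union_mset_add_mset_right)
qed (simp add: assms(2))

lemma composite_power:
  assumes "x \<noteq> y"
  shows "composite (replicate_mset n (pairing x y)) (\<gamma> x y ^^ n)"
proof (induction n)
  case 0
  show ?case by (simp add: composite_id id_def[symmetric])
next
  case (Suc n)
  then show ?case using composite_step[OF Suc assms]
    by (simp only: funpow_Suc_right replicate_mset_Suc)
qed

lemma composite_sup_inf:
  assumes "composite M \<phi>"
  shows "\<phi> (x \<squnion> y) = \<phi> x \<squnion> \<phi> y" "\<phi> (x \<sqinter> y) = \<phi> x \<sqinter> \<phi> y"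
  using assms by (induction arbitrary: x y rule: composite.induct) simp_all

lemma composite_le_top: "composite M \<phi> \<Longrightarrow> \<phi> x \<le> \<phi> \<top>"
  by (metis composite_sup_inf(2) inf_le2 inf_top_right)

text \<open>The image of a generator is an initial part of that generator, determined by the image of \<open>\<top>\<close>.
  Together with the next lemma this makes every computation one with generators, atomic elements and
  the single unknown \<open>\<phi> \<top>\<close>, which then drops out.\<close>

lemma composite_gen: "composite M \<phi> \<Longrightarrow> \<phi> (gen i) = gen i \<sqinter> \<phi> \<top>"
proof (induction rule: composite.induct)
  case (composite_step M \<phi> x y)
  have "\<phi> (q x y) \<le> \<phi> \<top>" using composite_step(1) by (rule composite_le_top)
  then show ?case
    using composite_step composite_sup_inf(2)[OF composite_step(1)]
    by (simp add: inf_assoc inf_absorb2)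
qed simp

lemma composite_atomic:
  assumes "composite M \<phi>" "a \<noteq> b"
  shows "\<phi> (atomic a b n) = \<phi> \<top> \<sqinter> atomic a b (n + count M (pairing a b))"
  using assms
proof (induction arbitrary: n rule: composite.induct)
  case (composite_step M \<phi> x y)
  have "\<phi> (q x y) \<le> \<phi> \<top>" using composite_step(1) by (rule composite_le_top)
  then show ?case
    using composite_step composite_sup_inf(2)[OF composite_step(1)]
    by (simp add: \<gamma>_atomic inf_absorb1 flip: inf_assoc)
qed simp


lemma atomic_1: "i \<noteq> j \<Longrightarrow> atomic i j (Suc 0) = gen i \<squnion> gen j"
  using other_indices[of i j] atomic_Suc[of i j _ _ 0] by (metis atomic.simps(1) inf_top_right)

lemma gen_inf_atomic_pair:
  assumes "{i, j, k, l} = UNIV" "{a, a'} = {k, l}"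
  shows "gen i \<sqinter> atomic a a' n = gen i \<sqinter> atomic k l n"
proof -
  have "{j, i, k, l} = UNIV" using assms(1) by (simp add: insert_commute)
  from gen_inf_atomic_commute[OF this] show ?thesis using assms(2) by (auto simp: doubleton_eq_iff)
qed

lemma gen_inf_q:
  assumes "{i, j, k, l} = UNIV"
  shows "gen i \<sqinter> q i j = gen i \<sqinter> (gen k \<squnion> gen l)"
  unfolding q_eq[OF assms] by (simp add: inf_sup_absorb flip: inf_assoc)

lemma composite_gen_q:
  assumes "composite M \<phi>" "{i, j, k, l} = UNIV"
  shows "\<phi> (gen i \<sqinter> q i j) = \<phi> (gen i) \<sqinter> atomic k l (Suc (count M (pairing i j)))"
proof -
  have d: "k \<noteq> l" using UNIV_distinct[OF assms(2)] by simp
  have "gen i \<sqinter> q i j = gen i \<sqinter> atomic k l (Suc 0)"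
    unfolding atomic_1[OF d] by (rule gen_inf_q[OF assms(2)])
  then have "\<phi> (gen i \<sqinter> q i j) = \<phi> (gen i) \<sqinter> (\<phi> \<top> \<sqinter> atomic k l (Suc (count M (pairing i j))))"
    using composite_sup_inf(2)[OF assms(1)] composite_atomic[OF assms(1) d] pairings_of[OF assms(2)]
    by simp
  then show ?thesis
    using composite_le_top[OF assms(1)] by (simp add: inf_absorb1 flip: inf_assoc)
qed

lemma inf_drop:
  fixes u v :: D4
  assumes "u \<le> v"
  shows "x \<sqinter> (v \<sqinter> (y \<sqinter> z)) \<sqinter> u = x \<sqinter> (u \<sqinter> (y \<sqinter> z))"
    and "x \<sqinter> (y \<sqinter> (v \<sqinter> z)) \<sqinter> u = x \<sqinter> (y \<sqinter> (u \<sqinter> z))"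
    and "x \<sqinter> (y \<sqinter> (z \<sqinter> v)) \<sqinter> u = x \<sqinter> (y \<sqinter> (z \<sqinter> u))"
proof -
  have "v \<sqinter> w \<sqinter> u = u \<sqinter> w" for w
    using assms by (metis inf.absorb1 inf.commute inf.left_commute)
  from this[of \<top>] this[of "x \<sqinter> y \<sqinter> z"]
  show "x \<sqinter> (v \<sqinter> (y \<sqinter> z)) \<sqinter> u = x \<sqinter> (u \<sqinter> (y \<sqinter> z))"
    "x \<sqinter> (y \<sqinter> (v \<sqinter> z)) \<sqinter> u = x \<sqinter> (y \<sqinter> (u \<sqinter> z))"
    "x \<sqinter> (y \<sqinter> (z \<sqinter> v)) \<sqinter> u = x \<sqinter> (y \<sqinter> (z \<sqinter> u))"
    by (simp_all only: inf_assoc inf_commute inf_left_commute)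
qed

text \<open>A further innermost factor \<open>\<gamma> i j\<close> meets \<open>gen i\<close> with \<open>atomic k l 1\<close>, whose image has a lower index
  one larger than before; since atomic elements decrease in the lower index, this new factor absorbs
  the old one.\<close>

lemma composite_gen_value:
  assumes "composite M \<phi>" and U: "{i, j, k, l} = UNIV"
    and a: "{a, a'} = {k, l}" and b: "{b, b'} = {j, l}" and c: "{c, c'} = {j, k}"
  shows "\<phi> (gen i) = gen i \<sqinter> atomic a a' (count M (pairing i j)) \<sqinter>
    atomic b b' (count M (pairing i k)) \<sqinter> atomic c c' (count M (pairing i l))"
proof -
  have V: "{i, k, j, l} = UNIV" "{i, l, j, k} = UNIV" using U by (simp_all add: insert_commute)
  have d: "distinct [i, j, k, l]" by (rule UNIV_distinct[OF U])
  have *: "\<phi> (gen i) = gen i \<sqinter> (atomic k l (count M (pairing i j)) \<sqinter>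
    (atomic j l (count M (pairing i k)) \<sqinter> atomic j k (count M (pairing i l))))"
    using assms(1)
  proof (induction rule: composite.induct)
    case (composite_step M \<phi> x y)
    have dec: "atomic u v (Suc n) \<le> atomic u v n" if "u \<noteq> v" for u v n
      using that by (rule atomic_decreasing)
    consider "pairing x y = pairing i j" | "pairing x y = pairing i k" | "pairing x y = pairing i l"
      using pairing_cases[OF U composite_step(2)] by blast
    then show ?case
    proof cases
      case 1
      have e: "(\<phi> \<circ> \<gamma> x y) (gen i) = \<phi> (gen i \<sqinter> q i j)"
        by (subst q_pairing[OF composite_step(2) _ 1, symmetric]) (use d in simp_all)
      have "k \<noteq> l" using d by simp
      note drop = dec[OF this]
      show ?thesis
        unfolding e composite_gen_q[OF composite_step(1) U] composite_step(3) inf_drop(1)[OF drop]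
        using pairings_of(4-6)[OF U] by (simp add: 1)
    next
      case 2
      have e: "(\<phi> \<circ> \<gamma> x y) (gen i) = \<phi> (gen i \<sqinter> q i k)"
        by (subst q_pairing[OF composite_step(2) _ 2, symmetric]) (use d in simp_all)
      have "j \<noteq> l" using d by simp
      note drop = dec[OF this]
      show ?thesis
        unfolding e composite_gen_q[OF composite_step(1) V(1)] composite_step(3) inf_drop(2)[OF drop]
        using pairings_of(4-6)[OF U] by (simp add: 2)
    next
      case 3
      have e: "(\<phi> \<circ> \<gamma> x y) (gen i) = \<phi> (gen i \<sqinter> q i l)"
        by (subst q_pairing[OF composite_step(2) _ 3, symmetric]) (use d in simp_all)
      have "j \<noteq> k" using d by simp
      note drop = dec[OF this]
      show ?thesis
        unfolding e composite_gen_q[OF composite_step(1) V(2)] composite_step(3) inf_drop(3)[OF drop]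
        using pairings_of(4-6)[OF U] by (simp add: 3)
    qed
  qed simp
  have split: "x \<sqinter> u \<sqinter> v \<sqinter> w = (x \<sqinter> u) \<sqinter> (x \<sqinter> v) \<sqinter> (x \<sqinter> w)" for x u v w :: D4
    by (simp add: inf_commute inf_left_commute)
  have "\<phi> (gen i) = gen i \<sqinter> atomic k l (count M (pairing i j)) \<sqinter>
      atomic j l (count M (pairing i k)) \<sqinter> atomic j k (count M (pairing i l))"
    unfolding * by (simp only: inf_assoc)
  also note split
  also note gen_inf_atomic_pair[OF U a, symmetric]
  also note gen_inf_atomic_pair[OF V(1) b, symmetric]
  also note gen_inf_atomic_pair[OF V(2) c, symmetric]
  also note split[symmetric]
  finally show ?thesis .
qed

section \<open>Images of the elements \<open>f\<^sub>i\<^sub>0\<close>\<close>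

text \<open>This is \<open>e\<^sub>i (e\<^sub>j + e\<^sub>k + e\<^sub>l)\<close>, the element that the table assigns to the one-letter sequence
  \<open>i\<close>.\<close>

definition f_zero :: "4 \<Rightarrow> D4" where
  "f_zero i = gen i \<sqinter> Sup_fin (gen ` (- {i}))"

lemma f_zero_eq:
  assumes "{i, j, k, l} = UNIV"
  shows "f_zero i = gen i \<sqinter> (gen j \<squnion> gen k \<squnion> gen l)"
proof -
  have "- {i} = {j, k, l}" using assms UNIV_distinct[OF assms] by auto
  then show ?thesis by (simp add: f_zero_def sup_assoc)
qed

text \<open>The three generators in \<open>f\<^sub>i\<^sub>0\<close> are grouped as \<open>e\<^sub>j + (e\<^sub>k + e\<^sub>l)\<close>, where the second summand is
  \<open>atomic k l 1\<close>; the unknown \<open>\<phi> \<top>\<close> then disappears by the modular law.\<close>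

lemma composite_f_zero:
  assumes M: "composite M \<phi>" and U: "{i, j, k, l} = UNIV" and a: "{a, a'} = {k, l}"
  shows "\<phi> (f_zero i) = \<phi> (gen i) \<sqinter> (atomic a a' (Suc (count M (pairing i j))) \<squnion> \<phi> (gen j))"
proof -
  let ?A = "atomic a a' (Suc (count M (pairing i j)))"
  have d: "distinct [i, j, k, l]" by (rule UNIV_distinct[OF U])
  have aa: "a \<noteq> a'" "pairing a a' = pairing i j"
    using a d pairings_of[OF U] by (auto simp: doubleton_eq_iff pairing_sym)
  have "gen k \<squnion> gen l = atomic a a' (Suc 0)"
    using a aa atomic_1 by (auto simp: doubleton_eq_iff sup_commute)
  then have "\<phi> (f_zero i) = \<phi> (gen i) \<sqinter> (\<phi> (gen j) \<squnion> \<phi> \<top> \<sqinter> ?A)"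
    unfolding f_zero_eq[OF U] sup_assoc
    using composite_sup_inf[OF M] composite_atomic[OF M aa(1)] aa by simp
  also have "\<phi> (gen j) \<squnion> \<phi> \<top> \<sqinter> ?A = (\<phi> (gen j) \<squnion> ?A) \<sqinter> \<phi> \<top>"
    using D4_modular[OF composite_le_top[OF M]] by (simp add: inf_commute)
  finally show ?thesis
    using composite_le_top[OF M, of "gen i"] by (metis inf.absorb1 inf_left_commute inf_commute sup_commute)
qed

text \<open>The modular law in the form in which a common upper bound of two of the elements can be inserted
  or removed as a factor of the third.\<close>

lemma inf_sup_restrict:
  fixes x a y c :: D4
  assumes "x \<le> c" "a \<le> c"
  shows "x \<sqinter> (a \<squnion> c \<sqinter> y) = x \<sqinter> (a \<squnion> y)"
proof -
  have "a \<squnion> c \<sqinter> y = (a \<squnion> y) \<sqinter> c" using D4_modular[OF assms(2)] by (simp add: inf_commute)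
  then show ?thesis using assms(1) by (metis inf.absorb1 inf_assoc inf_commute)
qed

lemma composite_gen_le_atomic:
  assumes "composite M \<phi>" "{i, j, k, l} = UNIV" "{a, a'} = {k, l}"
  shows "\<phi> (gen i) \<le> atomic a a' (count M (pairing i j))"
  by (subst composite_gen_value[OF assms HOL.refl HOL.refl]) (simp add: le_infI1)

text \<open>In the image of \<open>e\<^sub>j\<close> the factor belonging to the split \<open>{i, j}\<close> can be left out, as
  it bounds both \<open>\<phi> (gen i)\<close> and the other summand.\<close>

lemma composite_f_zero_partner:
  assumes M: "composite M \<phi>" and U: "{i, j, k, l} = UNIV"
    and a: "{a, a'} = {k, l}" and b: "{b, b'} = {i, k}" and c: "{c, c'} = {i, l}"
  shows "\<phi> (f_zero i) = \<phi> (gen i) \<sqinter> (atomic a a' (Suc (count M (pairing i j))) \<squnion>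
     gen j \<sqinter> atomic b b' (count M (pairing i k)) \<sqinter> atomic c c' (count M (pairing i l)))"
proof -
  let ?n = "count M (pairing i j)"
  have V: "{j, i, k, l} = UNIV" using U by (simp add: insert_commute)
  have "a \<noteq> a'" using a UNIV_distinct[OF U] by (auto simp: doubleton_eq_iff)
  then have dec: "atomic a a' (Suc ?n) \<le> atomic a a' ?n" by (rule atomic_decreasing)
  have "\<phi> (gen j) = atomic a a' ?n \<sqinter>
      (gen j \<sqinter> atomic b b' (count M (pairing i k)) \<sqinter> atomic c c' (count M (pairing i l)))"
    using composite_gen_value[OF M V a c b] pairings_of[OF U]
    by (simp add: pairing_sym[of j i] inf_commute inf_left_commute)
  then show ?thesis
    unfolding composite_f_zero[OF M U a]
    using inf_sup_restrict[OF composite_gen_le_atomic[OF M U a] dec] by simp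
qed

lemma composite_exists: "proper M \<Longrightarrow> \<exists>\<phi>. composite M \<phi>"
proof (induction M)
  case (add P M)
  then obtain \<phi> x y where "composite M \<phi>" "x \<noteq> y" "P = pairing x y"
    by (auto simp: proper_def)
  then show ?case using composite_step by blast
qed (use composite_id in blast)

lemma composite_proper: "composite M \<phi> \<Longrightarrow> proper M"
  by (induction rule: composite.induct) (auto simp: proper_def)

lemma composite_unique:
  assumes "composite M \<phi>" "composite M \<psi>"
  shows "\<phi> (gen i) = \<psi> (gen i)" "\<phi> (f_zero i) = \<psi> (f_zero i)"
proof -
  obtain j :: 4 where "i \<noteq> j"
    by (metis UNIV_index UNIV_distinct distinct_length_2_or_more)
  then obtain k l where U: "{i, j, k, l} = UNIV" using other_indices by blast
  show *: "\<phi> (gen i) = \<psi> (gen i)"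
    using composite_gen_value[OF assms(1) U HOL.refl HOL.refl HOL.refl]
      composite_gen_value[OF assms(2) U HOL.refl HOL.refl HOL.refl] by simp
  show "\<phi> (f_zero i) = \<psi> (f_zero i)"
    using composite_f_zero_partner[OF assms(1) U HOL.refl HOL.refl HOL.refl]
      composite_f_zero_partner[OF assms(2) U HOL.refl HOL.refl HOL.refl] * by simp
qed

lemma \<gamma>_f_zero:
  assumes U: "{i, j, k, l} = UNIV"
  shows "\<gamma> i l (f_zero i) = gen i \<sqinter> (gen j \<squnion> gen k) \<sqinter> (gen i \<sqinter> (gen k \<squnion> gen l) \<squnion> (gen j \<squnion> gen l))"
proof -
  have d: "distinct [i, j, k, l]" by (rule UNIV_distinct[OF U])
  have V: "{i, k, j, l} = UNIV" "{i, l, j, k} = UNIV" "{k, j, i, l} = UNIV" using U by (simp_all add: insert_commute)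
  have g: "composite {#pairing i l#} (\<gamma> i l)"
    using composite_step[OF composite_id, of i l] d by simp
  have e: "\<gamma> i l (gen i) = gen i \<sqinter> (gen j \<squnion> gen k)"
    using gen_inf_q[OF V(2)] by simp
  have "\<gamma> i l (gen k) = gen k \<sqinter> (gen i \<squnion> gen l)"
  proof -
    have "q i l = q k j" using pairings_of[OF U] d by (intro q_pairing) (auto simp: pairing_sym[of k j])
    then show ?thesis using gen_inf_q[OF V(3)] by simp
  qed
  \<comment> \<open>Two readings of \<open>(gen l \<squnion> gen k) \<sqinter> (gen i \<squnion> gen l)\<close> by the modular law.\<close>
  then have "gen l \<squnion> \<gamma> i l (gen k) = (gen l \<squnion> gen k) \<sqinter> (gen i \<squnion> gen l)"
    using D4_modular[of "gen l" "gen i \<squnion> gen l" "gen k"] by simp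
  also have "\<dots> = gen l \<squnion> gen i \<sqinter> (gen k \<squnion> gen l)"
    using D4_modular[of "gen l" "gen k \<squnion> gen l" "gen i"] by (metis inf_commute sup_commute sup_ge2)
  finally have "gen l \<squnion> \<gamma> i l (gen k) = gen l \<squnion> gen i \<sqinter> (gen k \<squnion> gen l)" .
  then show ?thesis
    using composite_f_zero[OF g V(1) HOL.refl] pairings_of[OF U] d unfolding e
    by (simp add: atomic_1 sup_commute sup_left_commute sup_assoc del: \<gamma>_simps)
qed

text \<open>If the split \<open>{i, l}\<close> occurs, one of its endomorphisms can be assumed to act first, and
  \<open>\<gamma> i l (f_zero i)\<close> is an expression in atomic elements of lower index \<open>1\<close>.  The remaining factors
  only shift the lower indices, and the surplus factors \<open>W\<close> below are bounds that can be dropped.\<close>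

lemma composite_f_zero_sum:
  assumes M: "composite M \<phi>" and U: "{i, j, k, l} = UNIV" and pos: "count M (pairing i l) \<ge> 1"
    and a: "{a, a'} = {k, l}" and b: "{b, b'} = {j, l}" and c: "{c, c'} = {j, k}"
  shows "\<phi> (f_zero i) = \<phi> (gen i) \<sqinter> (gen i \<sqinter> atomic a a' (Suc (count M (pairing i j))) \<squnion>
     atomic b b' (Suc (count M (pairing i k))) \<sqinter> atomic c c' (count M (pairing i l) - 1))"
proof -
  have d: "distinct [i, j, k, l]" by (rule UNIV_distinct[OF U])
  have dd: "a \<noteq> a'" "b \<noteq> b'" "c \<noteq> c'" using d a b c by (auto simp: doubleton_eq_iff)
  define N where "N = M - {#pairing i l#}"
  have MN: "M = add_mset (pairing i l) N" using pos by (simp add: N_def)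
  have "\<exists>\<psi>. composite N \<psi>"
    by (rule composite_exists) (use composite_proper[OF M] MN in \<open>simp add: proper_def\<close>)
  then obtain \<psi> where N: "composite N \<psi>" by blast
  have NM: "composite M (\<psi> \<circ> \<gamma> i l)" unfolding MN using N d by (intro composite_step) simp_all
  define t where "t = count N (pairing i j)"
  define s where "s = count N (pairing i k)"
  define r where "r = count N (pairing i l)"
  have cM: "count M (pairing i j) = t" "count M (pairing i k) = s" "count M (pairing i l) = Suc r"
    using pairings_of[OF U] by (simp_all add: MN t_def s_def r_def)
  have pa: "pairing a a' = pairing i j" "pairing b b' = pairing i k" "pairing c c' = pairing i l"
    using a b c pairings_of[OF U] by (auto simp: doubleton_eq_iff pairing_sym)
  have gv: "\<phi> (gen i) = gen i \<sqinter> atomic a a' t \<sqinter> atomic b b' s \<sqinter> atomic c c' (Suc r)"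
    using composite_gen_value[OF M U a b c] cM by simp
  have gv': "\<psi> (gen i) = gen i \<sqinter> atomic a a' t \<sqinter> atomic b b' s \<sqinter> atomic c c' r"
    using composite_gen_value[OF N U a b c] by (simp add: t_def s_def r_def)
  define W where "W = atomic b b' s \<sqinter> atomic c c' r"
  define X where "X = gen i \<sqinter> atomic a a' (Suc t)"
  define Y where "Y = atomic b b' (Suc s)"
  have le: "atomic a a' (Suc t) \<le> atomic a a' t" "Y \<le> atomic b b' s" "atomic c c' (Suc r) \<le> atomic c c' r"
    unfolding Y_def using dd by (simp_all add: atomic_decreasing)
  have XW: "\<psi> (gen i) \<sqinter> atomic a a' (Suc t) = W \<sqinter> X"
    unfolding gv' X_def W_def
    using inf_drop(1)[OF le(1), of "gen i" "atomic b b' s" "atomic c c' r"]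
    by (simp add: inf_assoc inf_commute inf_left_commute)
  have YW: "W \<sqinter> Y = Y \<sqinter> atomic c c' r"
    unfolding W_def using inf_absorb2[OF le(2)] by (metis inf_commute inf_assoc)
  have fT: "\<phi> (gen i) \<le> \<psi> \<top>"
  proof -
    have "\<phi> (gen i) \<le> \<psi> (gen i)" unfolding gv gv' using le(3) by (intro inf_mono order_refl)
    then show ?thesis using composite_le_top[OF N] order_trans by blast
  qed
  have fW: "\<phi> (gen i) \<le> W"
    unfolding gv W_def using le(3) by (auto intro: le_infI1 le_infI2)
  \<comment> \<open>In this form the image under \<open>\<psi>\<close> is computed by raising lower indices.\<close>
  have step: "\<gamma> i l (f_zero i) = gen i \<sqinter> atomic c c' (Suc 0) \<sqinter> (gen i \<sqinter> atomic a a' (Suc 0) \<squnion> atomic b b' (Suc 0))"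
    using \<gamma>_f_zero[OF U] a b c dd by (auto simp: atomic_1 doubleton_eq_iff sup_commute)
  have "\<phi> (f_zero i) = \<psi> (\<gamma> i l (f_zero i))"
    using composite_unique(2)[OF M NM] by simp
  also have "\<dots> = \<psi> (gen i) \<sqinter> (\<psi> \<top> \<sqinter> atomic c c' (Suc r)) \<sqinter>
      (\<psi> (gen i) \<sqinter> (\<psi> \<top> \<sqinter> atomic a a' (Suc t)) \<squnion> \<psi> \<top> \<sqinter> Y)"
    unfolding step composite_sup_inf[OF N] composite_atomic[OF N dd(1)] composite_atomic[OF N dd(2)]
      composite_atomic[OF N dd(3)] Y_def t_def s_def r_def pa by simp
  also have "\<psi> (gen i) \<sqinter> (\<psi> \<top> \<sqinter> atomic c c' (Suc r)) = \<phi> (gen i)"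
  proof -
    have "\<psi> (gen i) \<sqinter> (\<psi> \<top> \<sqinter> atomic c c' (Suc r)) = \<psi> (gen i) \<sqinter> atomic c c' (Suc r)"
      using composite_le_top[OF N] by (simp add: inf_absorb1 flip: inf_assoc)
    then show ?thesis unfolding gv gv' using inf_absorb2[OF le(3)] by (simp add: inf_assoc)
  qed
  also have "\<psi> (gen i) \<sqinter> (\<psi> \<top> \<sqinter> atomic a a' (Suc t)) = W \<sqinter> X"
    using composite_le_top[OF N] XW by (simp add: inf_absorb1 flip: inf_assoc)
  also have "\<phi> (gen i) \<sqinter> (W \<sqinter> X \<squnion> \<psi> \<top> \<sqinter> Y) = \<phi> (gen i) \<sqinter> (W \<sqinter> X \<squnion> Y)"
  proof (rule inf_sup_restrict[OF fT])
    show "W \<sqinter> X \<le> \<psi> \<top>" unfolding XW[symmetric] using composite_le_top[OF N] by (rule le_infI1)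
  qed
  also have "\<dots> = \<phi> (gen i) \<sqinter> (W \<sqinter> X \<squnion> W \<sqinter> Y)"
    using inf_sup_restrict[OF fW, of "W \<sqinter> X"] by simp
  also have "\<dots> = \<phi> (gen i) \<sqinter> (X \<squnion> W \<sqinter> Y)"
    using inf_sup_restrict[OF fW, of "W \<sqinter> Y" X] by (simp add: sup_commute)
  finally show ?thesis unfolding YW unfolding X_def Y_def cM diff_Suc_1 .
qed

text \<open>Both sides equal \<open>(gen i \<squnion> gen k) \<sqinter> (gen j \<squnion> gen k)\<close>: modulo \<open>gen k\<close>, one generator may be
  traded for the other if at the same time one split is traded for another.\<close>

lemma sup_\<gamma>_exchange:
  assumes "{i, j, k, l} = UNIV"
  shows "gen k \<squnion> \<gamma> i k (gen j) = gen k \<squnion> \<gamma> i l (gen i)"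
proof -
  have V: "{i, k, j, l} = UNIV" "{i, l, j, k} = UNIV" "{j, l, i, k} = UNIV" using assms by (simp_all add: insert_commute)
  have j: "\<gamma> i k (gen j) = gen j \<sqinter> (gen i \<squnion> gen k)"
  proof -
    have "q i k = q j l"
      using pairings_of[OF assms] UNIV_distinct[OF assms] by (intro q_pairing) auto
    then show ?thesis using gen_inf_q[OF V(3)] by simp
  qed
  have i: "\<gamma> i l (gen i) = gen i \<sqinter> (gen j \<squnion> gen k)"
    using gen_inf_q[OF V(2)] by simp
  have "gen k \<squnion> gen j \<sqinter> (gen i \<squnion> gen k) = (gen k \<squnion> gen j) \<sqinter> (gen i \<squnion> gen k)"
    by (rule D4_modular[symmetric]) simp
  also have "\<dots> = (gen k \<squnion> gen i) \<sqinter> (gen j \<squnion> gen k)"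
    by (metis inf_commute sup_commute)
  also have "\<dots> = gen k \<squnion> gen i \<sqinter> (gen j \<squnion> gen k)"
    by (rule D4_modular) simp
  finally show ?thesis unfolding i j .
qed

text \<open>Two trades, the first modulo \<open>gen k\<close> and the second modulo \<open>gen l\<close>, lead from \<open>gen j\<close> back to
  \<open>gen j\<close> and turn two occurrences of one split into two of the other.  The images of \<open>gen k\<close> and
  \<open>gen l\<close> lie below the atomic summand, so the trades do not change the join.\<close>

lemma composite_exchange:
  assumes M: "composite M \<phi>" and U: "{i, j, k, l} = UNIV" and a: "{a, a'} = {k, l}"
  shows "atomic a a' (Suc (count M (pairing i j))) \<squnion> \<phi> (\<gamma> i k (\<gamma> i k (gen j))) =
    atomic a a' (Suc (count M (pairing i j))) \<squnion> \<phi> (\<gamma> i l (\<gamma> i l (gen j)))" (is "?A \<squnion> _ = _")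
proof -
  have d: "distinct [i, j, k, l]" by (rule UNIV_distinct[OF U])
  have V: "{i, j, l, k} = UNIV" using U by (simp add: insert_commute)
  have aa: "a \<noteq> a'" "pairing a a' = pairing i j"
    using a d pairings_of[OF U] by (auto simp: doubleton_eq_iff pairing_sym)
  have absorb: "\<psi> (gen z) \<le> ?A" if "composite N \<psi>" "count N (pairing i j) = count M (pairing i j)" "z \<in> {k, l}" for N \<psi> z
  proof -
    have "gen z \<le> atomic a a' (Suc 0)" using that(3) a aa atomic_1 by (auto simp: doubleton_eq_iff)
    then have "\<psi> (gen z) \<le> \<psi> (atomic a a' (Suc 0))"
      using composite_sup_inf(2)[OF that(1)] by (metis inf.absorb_iff1)
    also have "\<dots> \<le> ?A" using composite_atomic[OF that(1) aa(1)] that(2) aa(2) by simp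
    finally show ?thesis .
  qed
  have K: "composite (add_mset (pairing i k) M) (\<phi> \<circ> \<gamma> i k)"
    and L: "composite (add_mset (pairing i l) M) (\<phi> \<circ> \<gamma> i l)"
    using M d by (auto intro: composite_step)
  have KL: "composite (add_mset (pairing i l) (add_mset (pairing i k) M)) (\<phi> \<circ> \<gamma> i k \<circ> \<gamma> i l)"
    and LK: "composite (add_mset (pairing i k) (add_mset (pairing i l) M)) (\<phi> \<circ> \<gamma> i l \<circ> \<gamma> i k)"
    using composite_step[OF K, of i l] composite_step[OF L, of i k] d by auto
  have "?A \<squnion> \<phi> (\<gamma> i k (\<gamma> i k (gen j))) = ?A \<squnion> (\<phi> \<circ> \<gamma> i k) (gen k \<squnion> \<gamma> i k (gen j))"
    unfolding composite_sup_inf[OF K] using absorb[OF K, of k] pairings_of[OF U]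
    by (simp add: sup_absorb1 flip: sup_assoc)
  also have "\<dots> = ?A \<squnion> (\<phi> \<circ> \<gamma> i k \<circ> \<gamma> i l) (gen i)"
    unfolding sup_\<gamma>_exchange[OF U] composite_sup_inf[OF K] using absorb[OF K, of k] pairings_of[OF U]
    by (simp add: sup_absorb1 flip: sup_assoc)
  \<comment> \<open>The order of the factors is irrelevant on generators; this sets up the second trade.\<close>
  also have "(\<phi> \<circ> \<gamma> i k \<circ> \<gamma> i l) (gen i) = (\<phi> \<circ> \<gamma> i l \<circ> \<gamma> i k) (gen i)"
    using composite_unique(1)[OF KL] LK by (simp add: add_mset_commute)
  also have "?A \<squnion> \<dots> = ?A \<squnion> (\<phi> \<circ> \<gamma> i l) (gen l \<squnion> \<gamma> i k (gen i))"
    unfolding composite_sup_inf[OF L] using absorb[OF L, of l] pairings_of[OF U]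
    by (simp add: sup_absorb1 flip: sup_assoc)
  also have "\<dots> = ?A \<squnion> \<phi> (\<gamma> i l (\<gamma> i l (gen j)))"
    unfolding sup_\<gamma>_exchange[OF V, symmetric] composite_sup_inf[OF L] using absorb[OF L, of l] pairings_of[OF U]
    by (simp add: sup_absorb1 flip: sup_assoc)
  finally show ?thesis .
qed

lemma atomic_exchange:
  assumes U: "{i, j, k, l} = UNIV" and a: "{a, a'} = {k, l}"
  shows "atomic a a' (Suc t) \<squnion> atomic a a' t \<sqinter> (gen j \<sqinter> atomic i k (s + 2) \<sqinter> atomic i l r) =
    atomic a a' (Suc t) \<squnion> atomic a a' t \<sqinter> (gen j \<sqinter> atomic i k s \<sqinter> atomic i l (r + 2))"
proof -
  have d: "distinct [i, j, k, l]" by (rule UNIV_distinct[OF U])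
  have V: "{j, i, k, l} = UNIV" using U by (simp add: insert_commute)
  define M where "M = replicate_mset t (pairing i j) + replicate_mset s (pairing i k) + replicate_mset r (pairing i l)"
  have "\<exists>\<phi>. composite M \<phi>" by (rule composite_exists) (use d in \<open>auto simp: M_def proper_def split: if_splits\<close>)
  then obtain \<phi> where M: "composite M \<phi>" by blast
  have K: "composite (add_mset (pairing i k) (add_mset (pairing i k) M)) (\<phi> \<circ> \<gamma> i k \<circ> \<gamma> i k)"
    and L: "composite (add_mset (pairing i l) (add_mset (pairing i l) M)) (\<phi> \<circ> \<gamma> i l \<circ> \<gamma> i l)"
    using M d by (auto intro!: composite_step simp del: o_apply)
  note c = pairings_of[OF U] pairings_of(4-6)[OF U, symmetric] pairing_sym[of j i]
  have cM: "count M (pairing i j) = t" "count M (pairing i k) = s" "count M (pairing i l) = r"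
    using c by (simp_all add: M_def)
  show ?thesis
    using composite_exchange[OF M U a] composite_gen_value[OF K V a HOL.refl HOL.refl] composite_gen_value[OF L V a HOL.refl HOL.refl] c cM
    by (simp add: inf_commute inf_left_commute)
qed

lemma atomic_swap:
  assumes U: "{i, j, k, l} = UNIV" and a: "{a, a'} = {k, l}" and ev: "even s" "even r"
  shows "atomic a a' (Suc t) \<squnion> atomic a a' t \<sqinter> (gen j \<sqinter> atomic i k s \<sqinter> atomic i l r) =
    atomic a a' (Suc t) \<squnion> atomic a a' t \<sqinter> (gen j \<sqinter> atomic i k r \<sqinter> atomic i l s)"
proof -
  let ?V = "\<lambda>s r. atomic a a' (Suc t) \<squnion> atomic a a' t \<sqinter> (gen j \<sqinter> atomic i k s \<sqinter> atomic i l r)"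
  \<comment> \<open>Both sides equal the expression in which all occurrences count for one of the two splits.\<close>
  have *: "?V (2 * m) n = ?V 0 (n + 2 * m)" for m n
  proof (induction m arbitrary: n)
    case (Suc m)
    then show ?case using atomic_exchange[OF U a, of t "2 * m" n] by simp
  qed simp
  obtain m n where "s = 2 * m" "r = 2 * n" using ev by (auto elim!: evenE)
  then show ?thesis using *[of m r] *[of n s] by (simp add: add.commute)
qed

text \<open>Several entries of the table state the second expression for \<open>f\<^sub>\<alpha>\<^sub>0\<close> with the two lower indices
  interchanged.  For even indices this is correct, because exchanging two occurrences at a time leads
  from one to the other; for indices of different parity it can fail.\<close>

lemma composite_f_zero_swapped:
  assumes M: "composite M \<phi>" and U: "{i, j, k, l} = UNIV"
    and a: "{a, a'} = {k, l}" and b: "{b, b'} = {i, k}" and c: "{c, c'} = {i, l}"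
    and ev: "even (count M (pairing i k))" "even (count M (pairing i l))"
  shows "\<phi> (f_zero i) = \<phi> (gen i) \<sqinter> (atomic a a' (Suc (count M (pairing i j))) \<squnion>
     gen j \<sqinter> atomic b b' (count M (pairing i l)) \<sqinter> atomic c c' (count M (pairing i k)))"
proof -
  let ?t = "count M (pairing i j)" and ?s = "count M (pairing i k)" and ?r = "count M (pairing i l)"
  have V: "{j, l, i, k} = UNIV" "{j, k, i, l} = UNIV" using U by (simp_all add: insert_commute)
  have "a \<noteq> a'" using a UNIV_distinct[OF U] by (auto simp: doubleton_eq_iff)
  then have dec: "atomic a a' (Suc ?t) \<le> atomic a a' ?t" by (rule atomic_decreasing)
  note restr = inf_sup_restrict[OF composite_gen_le_atomic[OF M U a] dec]
  have "\<phi> (f_zero i) = \<phi> (gen i) \<sqinter> (atomic a a' (Suc ?t) \<squnion> gen j \<sqinter> atomic i k ?s \<sqinter> atomic i l ?r)"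
    by (rule composite_f_zero_partner[OF M U a HOL.refl HOL.refl])
  also have "\<dots> = \<phi> (gen i) \<sqinter> (atomic a a' (Suc ?t) \<squnion> gen j \<sqinter> atomic i k ?r \<sqinter> atomic i l ?s)"
    using restr atomic_swap[OF U a ev] by metis
  also have "gen j \<sqinter> atomic i k ?r \<sqinter> atomic i l ?s = gen j \<sqinter> atomic b b' ?r \<sqinter> atomic c c' ?s"
    using gen_inf_atomic_pair[OF V(1) b] gen_inf_atomic_pair[OF V(2) c] by (metis inf_assoc inf_commute)
  finally show ?thesis .
qed

section \<open>Admissible sequences and their steps\<close>

text \<open>The invariant behind the identification of sequences.  Passing from an index to its neighbour is the
  action of an element of the Klein four-group, named by the split of the two neighbours.  Replacing
  \<open>ijl\<close> by \<open>ikl\<close> interchanges two consecutive group elements, so a class of sequences is determined by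
  one end and the multiset of steps.\<close>

fun steps :: "4 list \<Rightarrow> 4 set set multiset" where
  "steps (x # y # \<alpha>) = add_mset (pairing x y) (steps (y # \<alpha>))"
| "steps _ = {#}"

lemma steps_append: "steps (us @ x # vs) = steps (us @ [x]) + steps (x # vs)"
proof (induction us)
  case (Cons u us)
  then show ?case by (cases us) simp_all
qed simp

lemma steps_rev: "steps (rev \<alpha>) = steps \<alpha>"
proof (induction \<alpha> rule: steps.induct)
  case (1 x y \<alpha>)
  have "steps (rev (x # y # \<alpha>)) = steps (rev \<alpha> @ [y]) + steps [y, x]"
    using steps_append[of "rev \<alpha>" y "[x]"] by simp
  then show ?case using 1 by (simp add: pairing_sym[of y x])
qed simp_all

lemma distinct_adj_iff_steps: "distinct_adj \<alpha> \<longleftrightarrow> proper (steps \<alpha>)"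
  unfolding proper_def
proof (induction \<alpha> rule: steps.induct)
  case (1 x y \<alpha>)
  have "x \<noteq> y \<longleftrightarrow> (\<exists>x' y'. x' \<noteq> y' \<and> pairing x y = pairing x' y')"
    using pairing_refl_neq by metis
  then show ?case using 1 by simp
qed simp_all

lemma replacement_invariants:
  assumes "replacement \<alpha> \<beta>"
  shows "hd \<alpha> = hd \<beta>" "last \<alpha> = last \<beta>" "steps \<alpha> = steps \<beta>"
proof -
  from assms obtain i j k l us vs where U: "{i, j, k, l} = UNIV"
    and e: "\<alpha> = us @ [i, j, l] @ vs" "\<beta> = us @ [i, k, l] @ vs"
    by cases blast
  show "hd \<alpha> = hd \<beta>" "last \<alpha> = last \<beta>" unfolding e by (simp_all add: hd_append)
  show "steps \<alpha> = steps \<beta>"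
    unfolding e using pairings_of[OF U] steps_append[of us i "j # l # vs"] steps_append[of us i "k # l # vs"]
    by (simp add: add_mset_commute)
qed

lemma identified_invariants:
  assumes "identified \<alpha> \<beta>"
  shows "hd \<alpha> = hd \<beta>" "last \<alpha> = last \<beta>" "steps \<alpha> = steps \<beta>"
  using assms by (induction rule: rtranclp_induct) (simp_all add: replacement_invariants)

lemma replacement_sym: "replacement \<alpha> \<beta> \<Longrightarrow> replacement \<beta> \<alpha>"
proof (induction rule: replacement.induct)
  case (1 i j k l us vs)
  then have "{i, k, j, l} = UNIV" by (simp add: insert_commute)
  then show ?case by (rule replacement.intros)
qed

lemma identified_sym: "identified \<alpha> \<beta> \<Longrightarrow> identified \<beta> \<alpha>"
  by (induction rule: rtranclp_induct) (auto intro: converse_rtranclp_into_rtranclp replacement_sym)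

lemma identified_Cons: "identified \<alpha> \<beta> \<Longrightarrow> identified (x # \<alpha>) (x # \<beta>)"
proof (induction rule: rtranclp_induct)
  case (step \<beta> \<delta>)
  from step(2) have "replacement (x # \<beta>) (x # \<delta>)"
    by cases (metis append_Cons replacement.intros)
  then show ?case using step by simp
qed simp

lemma identified_rev: "identified \<alpha> \<beta> \<Longrightarrow> identified (rev \<alpha>) (rev \<beta>)"
proof (induction rule: rtranclp_induct)
  case (step \<beta> \<delta>)
  from step(2) have "replacement (rev \<beta>) (rev \<delta>)"
  proof cases
    case (1 i j k l us vs)
    then have "{l, j, k, i} = UNIV" by (simp add: insert_commute)
    then show ?thesis unfolding 1
      using replacement.intros[of l j k i "rev vs" "rev us"] by simp
  qed
  then show ?case using step by simp
qed simp

text \<open>If the wanted step occurs later, the induction hypothesis makes it the second step, and one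
  replacement interchanges it with the first.\<close>

lemma identified_step_first:
  assumes "distinct_adj (x # \<beta>)" "x \<noteq> y" "pairing x y \<in># steps (x # \<beta>)"
  shows "\<exists>\<beta>'. identified (x # \<beta>) (x # y # \<beta>')"
  using assms
proof (induction \<beta> arbitrary: x y)
  case (Cons z \<beta>)
  show ?case
  proof (cases "z = y")
    case False
    have "x \<noteq> z" using Cons.prems(1) by simp
    then obtain w where U: "{x, y, z, w} = UNIV"
      using fourth_index[of x y z] Cons.prems(2) False by auto
    have "pairing x y \<noteq> pairing x z" using pairing_inject[of y x z] False Cons.prems(2) by auto
    then have "pairing z w \<in># steps (z # \<beta>)"
      using Cons.prems(3) pairings_of[OF U] by simp
    moreover have "z \<noteq> w" "distinct_adj (z # \<beta>)" using UNIV_distinct[OF U] Cons.prems(1) by simp_all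
    ultimately obtain \<beta>' where "identified (z # \<beta>) (z # w # \<beta>')" using Cons.IH by blast
    then have "identified (x # z # \<beta>) (x # z # w # \<beta>')" by (rule identified_Cons)
    moreover have "{x, z, y, w} = UNIV" using U by (simp add: insert_commute)
    then have "replacement (x # z # w # \<beta>') (x # y # w # \<beta>')"
      using replacement.intros[of x z y w "[]" \<beta>'] by simp
    ultimately show ?thesis by (meson rtranclp.rtrancl_into_rtrancl)
  qed blast
qed simp

lemma identified_if_hd_steps:
  assumes "distinct_adj \<alpha>" "\<alpha> \<noteq> []" "\<beta> \<noteq> []" "hd \<alpha> = hd \<beta>" "steps \<alpha> = steps \<beta>"
  shows "identified \<alpha> \<beta>"
  using assms
proof (induction \<alpha> arbitrary: \<beta> rule: steps.induct)
  case (1 x y \<alpha>)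
  obtain \<beta>0 where \<beta>: "\<beta> = x # \<beta>0" using 1(4,5) by (cases \<beta>) auto
  have "distinct_adj \<beta>" using 1(2,6) by (simp only: distinct_adj_iff_steps)
  moreover have "pairing x y \<in># steps \<beta>" using 1(6)[symmetric] by simp
  ultimately obtain \<beta>' where i: "identified \<beta> (x # y # \<beta>')"
    using identified_step_first[of x \<beta>0 y] 1(2) unfolding \<beta> by auto
  have "steps (y # \<alpha>) = steps (y # \<beta>')" using identified_invariants(3)[OF i] 1(6) by simp
  then have "identified (y # \<alpha>) (y # \<beta>')" using 1(1)[of "y # \<beta>'"] 1(2) by simp
  then have "identified (x # y # \<alpha>) (x # y # \<beta>')" by (rule identified_Cons)
  then show ?case using identified_sym[OF i] by simp
next
  case ("2_2" x)
  then show ?case by (cases \<beta> rule: steps.cases) simp_all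
qed simp

text \<open>The table is organized by the start of a sequence, which is the last element of the list.\<close>

lemma identified_if_last_steps:
  assumes "distinct_adj \<alpha>" "\<alpha> \<noteq> []" "\<beta> \<noteq> []" "last \<alpha> = last \<beta>" "steps \<alpha> = steps \<beta>"
  shows "identified \<alpha> \<beta>"
proof -
  have "distinct_adj (rev \<alpha>)" using assms(1) by (simp add: distinct_adj_iff_steps steps_rev)
  then have "identified (rev \<alpha>) (rev \<beta>)"
    using assms by (intro identified_if_hd_steps) (simp_all add: steps_rev hd_rev)
  then show ?thesis using identified_rev by fastforce
qed

lemma steps_surj:
  assumes "proper M"
  shows "\<exists>\<alpha>. admissible \<alpha> \<and> hd \<alpha> = i \<and> steps \<alpha> = M"
proof -
  have "\<exists>\<alpha>. \<alpha> \<noteq> [] \<and> hd \<alpha> = i \<and> steps \<alpha> = M" using assms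
  proof (induction M arbitrary: i)
    case empty
    show ?case by (rule exI[of _ "[i]"]) simp
  next
    case (add P M)
    obtain x y where xy: "x \<noteq> y" "P = pairing x y" using add.prems by (auto simp: proper_def)
    obtain a :: 4 where "a \<noteq> i" by (metis UNIV_index UNIV_distinct distinct_length_2_or_more)
    then obtain b c where "{i, a, b, c} = UNIV" using other_indices by metis
    then obtain j where j: "P = pairing i j" using pairing_cases xy by metis
    have "proper M" using add.prems by (simp add: proper_def)
    then obtain \<alpha> where "\<alpha> \<noteq> []" "hd \<alpha> = j" "steps \<alpha> = M" using add.IH by blast
    then show ?case using j by (intro exI[of _ "i # \<alpha>"]) (cases \<alpha>, simp_all)
  qed
  then show ?thesis using assms by (auto simp: admissible_def distinct_adj_iff_steps)
qed

section \<open>The table of admissible elements\<close>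

lemma steps_rep [simp]:
  assumes "m \<noteq> a"
  shows "steps (a # rep [m, a] n @ \<beta>) = replicate_mset (2 * n) (pairing a m) + steps (a # \<beta>)"
  by (induction n) (simp_all add: rep_def pairing_sym[of m a])

lemma last_rep [simp]: "last (a # rep [m, a] n @ \<beta>) = last (a # \<beta>)"
  by (induction n) (simp_all add: rep_def)

lemma rep_Suc: "rep w (Suc n) = w @ rep w n"
  by (simp add: rep_def)

lemma steps_last_rep [simp]:
  "m \<noteq> a \<Longrightarrow> steps (a # rep [m, a] n) = replicate_mset (2 * n) (pairing a m)"
  "last (a # rep [m, a] n) = a"
  using steps_rep[of m a n "[]"] last_rep[of a m n "[]"] by simp_all

lemma rep_swap: "rep [a, d] n @ a # \<beta> = a # rep [d, a] n @ \<beta>"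
  by (induction n) (simp_all add: rep_def)

lemma map_rep: "map p (rep w n) = rep (map p w) n"
  by (simp add: rep_def map_concat)

text \<open>Four of the eight shapes of the table; the others arise from these by permuting the indices.\<close>

lemma steps_table:
  assumes U: "{a, b, c, d} = (UNIV :: 4 set)"
  shows "t \<ge> 1 \<Longrightarrow> steps (rep [b,a] t @ rep [d,a] r @ rep [c,a] s) = pairing_mset a b c d (2*t-1) (2*s) (2*r)"
    and "steps (a # rep [d,a] r @ rep [c,a] s @ rep [b,a] t) = pairing_mset a b c d (2*t) (2*s) (2*r)"
    and "r \<ge> 1 \<Longrightarrow> steps (b # rep [d,a] r @ rep [c,a] s @ rep [b,a] t) = pairing_mset a b c d (2*t) (2*s+1) (2*r-1)"
    and "r \<ge> 1 \<Longrightarrow> s \<ge> 1 \<Longrightarrow>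
      steps (rep [a,d] r @ rep [c,a] s @ rep [b,a] t) = pairing_mset a b c d (2*t+1) (2*s-1) (2*r-1)"
proof -
  have D: "b \<noteq> a" "c \<noteq> a" "d \<noteq> a" using UNIV_distinct[OF U] by auto
  note P = pairings_canonical[OF U]
  show "steps (a # rep [d,a] r @ rep [c,a] s @ rep [b,a] t) = pairing_mset a b c d (2*t) (2*s) (2*r)"
    using D by (simp add: pairing_mset_def)
  show "steps (rep [b,a] t @ rep [d,a] r @ rep [c,a] s) = pairing_mset a b c d (2*t-1) (2*s) (2*r)" if "t \<ge> 1"
    using D that by (cases t) (simp_all add: pairing_mset_def rep_Suc P)
  show "steps (b # rep [d,a] r @ rep [c,a] s @ rep [b,a] t) = pairing_mset a b c d (2*t) (2*s+1) (2*r-1)" if "r \<ge> 1"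
    using D that by (cases r) (simp_all add: pairing_mset_def rep_Suc P)
  show "steps (rep [a,d] r @ rep [c,a] s @ rep [b,a] t) = pairing_mset a b c d (2*t+1) (2*s-1) (2*r-1)"
    if rs: "r \<ge> 1" "s \<ge> 1"
  proof -
    obtain r' s' where e: "r = Suc r'" "s = Suc s'" using rs by (metis Suc_le_D One_nat_def)
    have "rep [a,d] r = rep [a,d] r' @ [a,d]"
      unfolding e by (induction r') (simp_all add: rep_def)
    then have eq: "rep [a,d] r @ rep [c,a] s @ rep [b,a] t = a # rep [d,a] r' @ d # c # a # rep [c,a] s' @ rep [b,a] t"
      unfolding e by (simp add: rep_Suc rep_swap)
    show ?thesis unfolding eq using D by (simp add: pairing_mset_def e P)
  qed
qed

lemma permuted_indices:
  assumes "bij p"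
  shows "{p 1, p 2, p 3, p (4::4)} = UNIV"
proof -
  have "p ` {1, 2, 3, 4} = UNIV" using bij_is_surj[OF assms] by (simp only: UNIV_index)
  then show ?thesis by simp
qed

text \<open>Each entry is one of the three general expressions for the image of \<open>f\<^sub>i\<^sub>0\<close>, for a suitable naming of
  the indices: first expressions are instances of \<open>composite_f_zero_sum\<close>, second expressions of
  \<open>composite_f_zero_partner\<close> or, in the first four types, of \<open>composite_f_zero_swapped\<close>.  In the last
  type both expressions are of the first kind.\<close>

lemma table_values:
  assumes tab: "adm_table p \<beta> x y" and p: "bij p" and M: "composite (steps (map p \<beta>)) \<phi>"
  shows "x = \<phi> (gen (p (hd \<beta>))) \<and> y = \<phi> (f_zero (p (hd \<beta>)))"
proof -
  define a b c d where abcd: "a = p 1" "b = p 2" "c = p 3" "d = p 4"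
  have U: "{a, b, c, d} = UNIV" unfolding abcd by (rule permuted_indices[OF p])
  note P = pairings_canonical[OF U] count_pairing_mset[OF U]
  have V_bacd: "{b, a, c, d} = UNIV" using U by (simp add: insert_commute)
  have V_badc: "{b, a, d, c} = UNIV" using U by (simp add: insert_commute)
  have V_cabd: "{c, a, b, d} = UNIV" using U by (simp add: insert_commute)
  have V_cadb: "{c, a, d, b} = UNIV" using U by (simp add: insert_commute)
  have V_dabc: "{d, a, b, c} = UNIV" using U by (simp add: insert_commute)
  have V_dacb: "{d, a, c, b} = UNIV" using U by (simp add: insert_commute)
  have V_adcb: "{a, d, c, b} = UNIV" using U by (simp add: insert_commute)
  have V_adbc: "{a, d, b, c} = UNIV" using U by (simp add: insert_commute)
  have V_bcda: "{b, c, d, a} = UNIV" using U by (simp add: insert_commute)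
  have V_bcad: "{b, c, a, d} = UNIV" using U by (simp add: insert_commute)
  have V_cbda: "{c, b, d, a} = UNIV" using U by (simp add: insert_commute)
  have V_cbad: "{c, b, a, d} = UNIV" using U by (simp add: insert_commute)
  have V_dcab: "{d, c, a, b} = UNIV" using U by (simp add: insert_commute)
  have V_acdb: "{a, c, d, b} = UNIV" using U by (simp add: insert_commute)
  have V_acbd: "{a, c, b, d} = UNIV" using U by (simp add: insert_commute)
  note V_abcd = U
  note S = steps_table[OF U] steps_table[OF V_acbd] steps_table[OF V_adcb] steps_table[OF V_adbc] pairing_mset_permute
  from tab M show ?thesis
  proof (induction rule: adm_table.induct)
    case (type_21_41_31 t x s r y)
    have t: "t \<ge> 1" "t > 0" using type_21_41_31(1) by simp_all
    have M: "composite (pairing_mset a b c d (2*t-1) (2*s) (2*r)) \<phi>"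
      using type_21_41_31(4) t by (simp add: map_rep S flip: abcd)
    have e: "\<phi> (gen b) = gen b \<sqinter> atomic c a (2*s) \<sqinter> atomic d a (2*r) \<sqinter> atomic c d (2*t-1)"
      using t composite_gen_value[OF M V_bacd, of c d d a c a]
      by (simp add: P insert_commute inf_commute inf_left_commute)
    have f1: "\<phi> (f_zero b) = \<phi> (gen b) \<sqinter> (gen b \<sqinter> atomic c d (2*t) \<squnion> atomic d a (2*r+1) \<sqinter> atomic c a (2*s-1))" if "s \<ge> 1"
      using t that composite_f_zero_sum[OF M V_bacd, of c d d a c a]
      by (simp add: P insert_commute inf_commute)
    have f2: "\<phi> (f_zero b) = \<phi> (gen b) \<sqinter> (atomic d c (2*t) \<squnion> gen a \<sqinter> atomic b d (2*r) \<sqinter> atomic b c (2*s))"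
      using t composite_f_zero_swapped[OF M V_badc, of d c b d b c]
      by (simp add: P insert_commute inf_commute)
    have "x = \<phi> (gen b) \<and> y = \<phi> (f_zero b)"
      using type_21_41_31(2,3) e f1 f2 unfolding abcd by metis
    then show ?case using t unfolding abcd by (cases t) (simp_all add: rep_Suc)
  next
    case (type_31_41_21 s x t r y)
    have s: "s \<ge> 1" "s > 0" using type_31_41_21(1) by simp_all
    have M: "composite (pairing_mset a b c d (2*t) (2*s-1) (2*r)) \<phi>"
      using type_31_41_21(4) s by (simp add: map_rep S flip: abcd)
    have e: "\<phi> (gen c) = gen c \<sqinter> atomic b a (2*t) \<sqinter> atomic d a (2*r) \<sqinter> atomic b d (2*s-1)"
      using s composite_gen_value[OF M V_cabd, of b d d a b a]
      by (simp add: P insert_commute inf_commute inf_left_commute)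
    have f1: "\<phi> (f_zero c) = \<phi> (gen c) \<sqinter> (gen c \<sqinter> atomic d b (2*s) \<squnion> atomic d a (2*r+1) \<sqinter> atomic b a (2*t-1))" if "t \<ge> 1"
      using s that composite_f_zero_sum[OF M V_cabd, of d b d a b a]
      by (simp add: P insert_commute inf_commute)
    have f2: "\<phi> (f_zero c) = \<phi> (gen c) \<sqinter> (atomic d b (2*s) \<squnion> gen a \<sqinter> atomic c d (2*r) \<sqinter> atomic c b (2*t))"
      using s composite_f_zero_swapped[OF M V_cadb, of d b c d c b]
      by (simp add: P insert_commute inf_commute)
    have "x = \<phi> (gen c) \<and> y = \<phi> (f_zero c)"
      using type_31_41_21(2,3) e f1 f2 unfolding abcd by metis
    then show ?case using s unfolding abcd by (cases s) (simp_all add: rep_Suc)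
  next
    case (type_41_31_21 r x t s y)
    have r: "r \<ge> 1" "r > 0" using type_41_31_21(1) by simp_all
    have M: "composite (pairing_mset a b c d (2*t) (2*s) (2*r-1)) \<phi>"
      using type_41_31_21(4) r by (simp add: map_rep S flip: abcd)
    have e: "\<phi> (gen d) = gen d \<sqinter> atomic b a (2*t) \<sqinter> atomic c a (2*s) \<sqinter> atomic c b (2*r-1)"
      using r composite_gen_value[OF M V_dabc, of c b c a b a]
      by (simp add: P insert_commute inf_commute inf_left_commute)
    have f1: "\<phi> (f_zero d) = \<phi> (gen d) \<sqinter> (gen d \<sqinter> atomic c b (2*r) \<squnion> atomic c a (2*s+1) \<sqinter> atomic b a (2*t-1))" if "t \<ge> 1"
      using r that composite_f_zero_sum[OF M V_dabc, of c b c a b a]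
      by (simp add: P insert_commute inf_commute)
    have f2: "\<phi> (f_zero d) = \<phi> (gen d) \<sqinter> (atomic c b (2*r) \<squnion> gen a \<sqinter> atomic d c (2*s) \<sqinter> atomic d b (2*t))"
      using r composite_f_zero_swapped[OF M V_dacb, of c b d c d b]
      by (simp add: P insert_commute inf_commute)
    have "x = \<phi> (gen d) \<and> y = \<phi> (f_zero d)"
      using type_41_31_21(2,3) e f1 f2 unfolding abcd by metis
    then show ?case using r unfolding abcd by (cases r) (simp_all add: rep_Suc)
  next
    case (type_1_41_31_21 x s t r y)
    have M: "composite (pairing_mset a b c d (2*t) (2*s) (2*r)) \<phi>"
      using type_1_41_31_21(3)  by (simp add: map_rep S flip: abcd)
    have e: "\<phi> (gen a) = gen a \<sqinter> atomic b d (2*s) \<sqinter> atomic c d (2*t) \<sqinter> atomic c b (2*r)"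
     using composite_gen_value[OF M V_abcd, of c d b d c b]
      by (simp add: P insert_commute inf_commute inf_left_commute)
    have f1: "\<phi> (f_zero a) = \<phi> (gen a) \<sqinter> (gen a \<sqinter> atomic c b (2*r+1) \<squnion> atomic b d (2*s+1) \<sqinter> atomic c d (2*t-1))" if "t \<ge> 1"
      using that composite_f_zero_sum[OF M V_adcb, of c b b d c d]
      by (simp add: P insert_commute inf_commute)
    have f2: "\<phi> (f_zero a) = \<phi> (gen a) \<sqinter> (atomic c b (2*r+1) \<squnion> gen d \<sqinter> atomic b a (2*s) \<sqinter> atomic c a (2*t))"
      using composite_f_zero_swapped[OF M V_adbc, of c b b a c a]
      by (simp add: P insert_commute inf_commute)
    have "x = \<phi> (gen a) \<and> y = \<phi> (f_zero a)"
      using type_1_41_31_21(1,2) e f1 f2 unfolding abcd by metis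
    then show ?case  unfolding abcd by simp
  next
    case (type_2_41_31_21 r x t s y)
    have r: "r \<ge> 1" "r > 0" using type_2_41_31_21(1) by simp_all
    have M: "composite (pairing_mset a b c d (2*t) (2*s+1) (2*r-1)) \<phi>"
      using type_2_41_31_21(4) r by (simp add: map_rep S flip: abcd)
    have e: "\<phi> (gen b) = gen b \<sqinter> atomic c d (2*t) \<sqinter> atomic c a (2*s+1) \<sqinter> atomic a d (2*r-1)"
      using r composite_gen_value[OF M V_bacd, of c d a d c a]
      by (simp add: P insert_commute inf_commute inf_left_commute)
    have f1: "\<phi> (f_zero b) = \<phi> (gen b) \<sqinter> (gen b \<sqinter> atomic a d (2*r) \<squnion> atomic c a (2*s+2) \<sqinter> atomic c d (2*t-1))" if "t \<ge> 1"
      using r that composite_f_zero_sum[OF M V_bcda, of a d c a c d]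
      by (simp add: P insert_commute inf_commute)
    have f2: "\<phi> (f_zero b) = \<phi> (gen b) \<sqinter> (atomic a d (2*r) \<squnion> gen c \<sqinter> atomic b a (2*t) \<sqinter> atomic b d (2*s+1))"
      using r composite_f_zero_partner[OF M V_bcad, of a d b a b d]
      by (simp add: P insert_commute inf_commute)
    have "x = \<phi> (gen b) \<and> y = \<phi> (f_zero b)"
      using type_2_41_31_21(2,3) e f1 f2 unfolding abcd by metis
    then show ?case using r unfolding abcd by simp
  next
    case (type_3_41_21_31 r x s t y)
    have r: "r \<ge> 1" "r > 0" using type_3_41_21_31(1) by simp_all
    have M: "composite (pairing_mset a b c d (2*t+1) (2*s) (2*r-1)) \<phi>"
      using type_3_41_21_31(4) r by (simp add: map_rep S flip: abcd)
    have e: "\<phi> (gen c) = gen c \<sqinter> atomic b d (2*s) \<sqinter> atomic b a (2*t+1) \<sqinter> atomic a d (2*r-1)"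
      using r composite_gen_value[OF M V_cabd, of b d a d b a]
      by (simp add: P insert_commute inf_commute inf_left_commute)
    have f1: "\<phi> (f_zero c) = \<phi> (gen c) \<sqinter> (gen c \<sqinter> atomic a d (2*r) \<squnion> atomic b a (2*t+2) \<sqinter> atomic b d (2*s-1))" if "s \<ge> 1"
      using r that composite_f_zero_sum[OF M V_cbda, of a d b a b d]
      by (simp add: P insert_commute inf_commute)
    have f2: "\<phi> (f_zero c) = \<phi> (gen c) \<sqinter> (atomic a d (2*r) \<squnion> gen b \<sqinter> atomic c a (2*s) \<sqinter> atomic c d (2*t+1))"
      using r composite_f_zero_partner[OF M V_cbad, of a d c a c d]
      by (simp add: P insert_commute inf_commute)
    have "x = \<phi> (gen c) \<and> y = \<phi> (f_zero c)"
      using type_3_41_21_31(2,3) e f1 f2 unfolding abcd by metis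
    then show ?case using r unfolding abcd by simp
  next
    case (type_4_21_31_41 t x r s y)
    have t: "t \<ge> 1" "t > 0" using type_4_21_31_41(1) by simp_all
    have M: "composite (pairing_mset a b c d (2*t-1) (2*s+1) (2*r)) \<phi>"
      using type_4_21_31_41(4) t by (simp add: map_rep S flip: abcd)
    have e: "\<phi> (gen d) = gen d \<sqinter> atomic c b (2*r) \<sqinter> atomic c a (2*s+1) \<sqinter> atomic a b (2*t-1)"
      using t composite_gen_value[OF M V_dabc, of c b c a a b]
      by (simp add: P insert_commute inf_commute inf_left_commute)
    have f1: "\<phi> (f_zero d) = \<phi> (gen d) \<sqinter> (gen d \<sqinter> atomic a b (2*t) \<squnion> atomic c a (2*s) \<sqinter> atomic c b (2*r+1))"
      using t composite_f_zero_sum[OF M V_dcab, of a b c b c a]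
      by (simp add: P insert_commute inf_commute)
    have f2: "\<phi> (f_zero d) = \<phi> (gen d) \<sqinter> (atomic a b (2*t) \<squnion> gen c \<sqinter> atomic d a (2*r) \<sqinter> atomic d b (2*s+1))"
      using t composite_f_zero_partner[OF M V_dcab, of a b d a d b]
      by (simp add: P insert_commute inf_commute)
    have "x = \<phi> (gen d) \<and> y = \<phi> (f_zero d)"
      using type_4_21_31_41(2,3) e f1 f2 unfolding abcd by metis
    then show ?case using t unfolding abcd by simp
  next
    case (type_14_31_21 r s x t y)
    have r: "r \<ge> 1" "r > 0" using type_14_31_21(1) by simp_all
    have s: "s \<ge> 1" "s > 0" using type_14_31_21(2) by simp_all
    have M: "composite (pairing_mset a b c d (2*t+1) (2*s-1) (2*r-1)) \<phi>"
      using type_14_31_21(5) r s by (simp add: map_rep S flip: abcd)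
    have e: "\<phi> (gen a) = gen a \<sqinter> atomic b c (2*r-1) \<sqinter> atomic b d (2*s-1) \<sqinter> atomic c d (2*t+1)"
      using r s composite_gen_value[OF M V_abcd, of c d b d b c]
      by (simp add: P insert_commute inf_commute inf_left_commute)
    have f1: "\<phi> (f_zero a) = \<phi> (gen a) \<sqinter> (gen a \<sqinter> atomic b c (2*r) \<squnion> atomic b d (2*s) \<sqinter> atomic c d (2*t))"
      using r s composite_f_zero_sum[OF M V_adcb, of b c b d c d]
      by (simp add: P insert_commute inf_commute)
    have f2: "\<phi> (f_zero a) = \<phi> (gen a) \<sqinter> (gen a \<sqinter> atomic b d (2*s) \<squnion> atomic c d (2*t) \<sqinter> atomic b c (2*r))"
      using r s composite_f_zero_sum[OF M V_acdb, of b d b c c d]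
      by (simp add: P insert_commute inf_commute)
    have "x = \<phi> (gen a) \<and> y = \<phi> (f_zero a)"
      using type_14_31_21(3,4) e f1 f2 unfolding abcd by metis
    then show ?case using r unfolding abcd by (cases r) (simp_all add: rep_Suc)
  qed
qed

lemma last_append_rep:
  assumes "n \<ge> 1"
  shows "last (us @ rep [m, a] n @ \<beta>) = last (a # \<beta>)"
proof (cases n)
  case (Suc k)
  then have "last (us @ rep [m, a] n @ \<beta>) = last ((us @ [m]) @ a # rep [m, a] k @ \<beta>)"
    by (simp add: rep_Suc)
  also have "\<dots> = last (a # rep [m, a] k @ \<beta>)" by (rule last_appendR) simp
  also have "\<dots> = last (a # \<beta>)" by (rule last_rep)
  finally show ?thesis .
qed (use assms in simp)

text \<open>The eight types correspond to the eight parities of the three numbers of steps.\<close>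

lemma table_exists:
  assumes p: "bij p"
  shows "\<exists>\<beta> x y. adm_table p \<beta> x y \<and> last \<beta> = 1 \<and>
    steps (map p \<beta>) = pairing_mset (p 1) (p 2) (p 3) (p 4) u v w"
proof -
  define a b c d where abcd: "a = p 1" "b = p 2" "c = p 3" "d = p 4"
  have U: "{a, b, c, d} = UNIV" unfolding abcd by (rule permuted_indices[OF p])
  have V: "{a, c, b, d} = UNIV" "{a, d, c, b} = UNIV" "{a, d, b, c} = UNIV"
    using U by (simp_all add: insert_commute)
  note S = steps_table[OF U] steps_table[OF V(1)] steps_table[OF V(2)] steps_table[OF V(3)] pairing_mset_permute
  have even_form: "\<exists>k. n = 2 * k" if "even n" for n :: nat using that by (rule evenE) blast
  have odd_form: "\<exists>k. n = 2 * k + 1" if "odd n" for n :: nat using that by (rule oddE) blast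
  have odd_form': "\<exists>k. n = 2 * k - 1 \<and> k \<ge> 1" if "odd n" for n :: nat
    using odd_form[OF that] by (auto intro: exI[of _ "Suc _"])
  consider "odd u" "even v" "even w"
    | "even u" "odd v" "even w"
    | "even u" "even v" "odd w"
    | "even u" "even v" "even w"
    | "even u" "odd v" "odd w"
    | "odd u" "even v" "odd w"
    | "odd u" "odd v" "even w"
    | "odd u" "odd v" "odd w" by blast
  then show ?thesis
  proof cases
    case 1
    obtain t s r where e: "u = 2*t-1" "v = 2*s" "w = 2*r" "t \<ge> 1"
      using odd_form'[OF 1(1)] even_form[OF 1(2)] even_form[OF 1(3)] by blast
    have "\<exists>x y. adm_table p (rep [2,1] t @ rep [4,1] r @ rep [3,1] s) x y"
      by (rule exI, rule exI, rule adm_table.type_21_41_31[OF _ HOL.refl disjI2[OF HOL.refl]]) (use e in simp_all)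
    moreover have "last (rep [2,1] t @ rep [4,1] r @ rep [3,1] s) = 1"
      using last_append_rep[OF e(4), of "[]" 2 1 "rep [4,1] r @ rep [3,1] s"] by (simp del: last.simps)
    moreover have "steps (map p (rep [2,1] t @ rep [4,1] r @ rep [3,1] s)) = pairing_mset a b c d u v w"
      using e by (simp add: map_rep S flip: abcd)
    ultimately show ?thesis unfolding abcd by blast
  next
    case 2
    obtain t s r where e: "u = 2*t" "v = 2*s-1" "w = 2*r" "s \<ge> 1"
      using even_form[OF 2(1)] odd_form'[OF 2(2)] even_form[OF 2(3)] by blast
    have "\<exists>x y. adm_table p (rep [3,1] s @ rep [4,1] r @ rep [2,1] t) x y"
      by (rule exI, rule exI, rule adm_table.type_31_41_21[OF _ HOL.refl disjI2[OF HOL.refl]]) (use e in simp_all)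
    moreover have "last (rep [3,1] s @ rep [4,1] r @ rep [2,1] t) = 1"
      using last_append_rep[OF e(4), of "[]" 3 1 "rep [4,1] r @ rep [2,1] t"] by (simp del: last.simps)
    moreover have "steps (map p (rep [3,1] s @ rep [4,1] r @ rep [2,1] t)) = pairing_mset a b c d u v w"
      using e by (simp add: map_rep S flip: abcd)
    ultimately show ?thesis unfolding abcd by blast
  next
    case 3
    obtain t s r where e: "u = 2*t" "v = 2*s" "w = 2*r-1" "r \<ge> 1"
      using even_form[OF 3(1)] even_form[OF 3(2)] odd_form'[OF 3(3)] by blast
    have "\<exists>x y. adm_table p (rep [4,1] r @ rep [3,1] s @ rep [2,1] t) x y"
      by (rule exI, rule exI, rule adm_table.type_41_31_21[OF _ HOL.refl disjI2[OF HOL.refl]]) (use e in simp_all)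
    moreover have "last (rep [4,1] r @ rep [3,1] s @ rep [2,1] t) = 1"
      using last_append_rep[OF e(4), of "[]" 4 1 "rep [3,1] s @ rep [2,1] t"] by (simp del: last.simps)
    moreover have "steps (map p (rep [4,1] r @ rep [3,1] s @ rep [2,1] t)) = pairing_mset a b c d u v w"
      using e by (simp add: map_rep S flip: abcd)
    ultimately show ?thesis unfolding abcd by blast
  next
    case 4
    obtain t s r where e: "u = 2*t" "v = 2*s" "w = 2*r"
      using even_form[OF 4(1)] even_form[OF 4(2)] even_form[OF 4(3)] by blast
    have "\<exists>x y. adm_table p ([1] @ rep [4,1] r @ rep [3,1] s @ rep [2,1] t) x y"
      by (rule exI, rule exI, rule adm_table.type_1_41_31_21[OF HOL.refl disjI2[OF HOL.refl]])
    moreover have "last ([1] @ rep [4,1] r @ rep [3,1] s @ rep [2,1] t) = 1"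
      by (simp del: last.simps)
    moreover have "steps (map p ([1] @ rep [4,1] r @ rep [3,1] s @ rep [2,1] t)) = pairing_mset a b c d u v w"
      using e by (simp add: map_rep S flip: abcd)
    ultimately show ?thesis unfolding abcd by blast
  next
    case 5
    obtain t s r where e: "u = 2*t" "v = 2*s+1" "w = 2*r-1" "r \<ge> 1"
      using even_form[OF 5(1)] odd_form[OF 5(2)] odd_form'[OF 5(3)] by blast
    have "\<exists>x y. adm_table p ([2] @ rep [4,1] r @ rep [3,1] s @ rep [2,1] t) x y"
      by (rule exI, rule exI, rule adm_table.type_2_41_31_21[OF _ HOL.refl disjI2[OF HOL.refl]]) (use e in simp_all)
    moreover have "last ([2] @ rep [4,1] r @ rep [3,1] s @ rep [2,1] t) = 1"
      using last_append_rep[OF e(4), of "[2]" 4 1 "rep [3,1] s @ rep [2,1] t"] by (simp del: last.simps)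
    moreover have "steps (map p ([2] @ rep [4,1] r @ rep [3,1] s @ rep [2,1] t)) = pairing_mset a b c d u v w"
      using e by (simp add: map_rep S flip: abcd)
    ultimately show ?thesis unfolding abcd by blast
  next
    case 6
    obtain t s r where e: "u = 2*t+1" "v = 2*s" "w = 2*r-1" "r \<ge> 1"
      using odd_form[OF 6(1)] even_form[OF 6(2)] odd_form'[OF 6(3)] by blast
    have "\<exists>x y. adm_table p ([3] @ rep [4,1] r @ rep [2,1] t @ rep [3,1] s) x y"
      by (rule exI, rule exI, rule adm_table.type_3_41_21_31[OF _ HOL.refl disjI2[OF HOL.refl]]) (use e in simp_all)
    moreover have "last ([3] @ rep [4,1] r @ rep [2,1] t @ rep [3,1] s) = 1"
      using last_append_rep[OF e(4), of "[3]" 4 1 "rep [2,1] t @ rep [3,1] s"] by (simp del: last.simps)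
    moreover have "steps (map p ([3] @ rep [4,1] r @ rep [2,1] t @ rep [3,1] s)) = pairing_mset a b c d u v w"
      using e by (simp add: map_rep S flip: abcd)
    ultimately show ?thesis unfolding abcd by blast
  next
    case 7
    obtain t s r where e: "u = 2*t-1" "v = 2*s+1" "w = 2*r" "t \<ge> 1"
      using odd_form'[OF 7(1)] odd_form[OF 7(2)] even_form[OF 7(3)] by blast
    have "\<exists>x y. adm_table p ([4] @ rep [2,1] t @ rep [3,1] s @ rep [4,1] r) x y"
      by (rule exI, rule exI, rule adm_table.type_4_21_31_41[OF _ HOL.refl disjI2[OF HOL.refl]]) (use e in simp_all)
    moreover have "last ([4] @ rep [2,1] t @ rep [3,1] s @ rep [4,1] r) = 1"
      using last_append_rep[OF e(4), of "[4]" 2 1 "rep [3,1] s @ rep [4,1] r"] by (simp del: last.simps)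
    moreover have "steps (map p ([4] @ rep [2,1] t @ rep [3,1] s @ rep [4,1] r)) = pairing_mset a b c d u v w"
      using e by (simp add: map_rep S flip: abcd)
    ultimately show ?thesis unfolding abcd by blast
  next
    case 8
    obtain t s r where e: "u = 2*t+1" "v = 2*s-1" "w = 2*r-1" "r \<ge> 1" "s \<ge> 1"
      using odd_form[OF 8(1)] odd_form'[OF 8(2)] odd_form'[OF 8(3)] by blast
    have "\<exists>x y. adm_table p (rep [1,4] r @ rep [3,1] s @ rep [2,1] t) x y"
      by (rule exI, rule exI, rule adm_table.type_14_31_21[OF _ _ HOL.refl disjI2[OF HOL.refl]]) (use e in simp_all)
    moreover have "last (rep [1,4] r @ rep [3,1] s @ rep [2,1] t) = 1"
      using last_append_rep[OF e(5), of "rep [1,4] r" 3 1 "rep [2,1] t"] by (simp del: last.simps)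
    moreover have "steps (map p (rep [1,4] r @ rep [3,1] s @ rep [2,1] t)) = pairing_mset a b c d u v w"
      using e by (simp add: map_rep S flip: abcd)
    ultimately show ?thesis unfolding abcd by blast
  qed
qed

section \<open>Admissible elements as images under composites\<close>

lemma indices_UNIV: "{1, 2, 3, 4 :: 4} = UNIV"
  by (rule UNIV_index[symmetric])

lemma composite_pairing_mset:
  assumes "{a, b, c, d} = UNIV"
  shows "composite (pairing_mset a b c d t s r) (\<gamma> a b ^^ t \<circ> \<gamma> a c ^^ s \<circ> \<gamma> a d ^^ r)"
  unfolding pairing_mset_def using UNIV_distinct[OF assms]
  by (intro composite_comp composite_power) auto

lemma identified_Nil: "identified \<alpha> \<beta> \<Longrightarrow> \<alpha> = [] \<longleftrightarrow> \<beta> = []"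
  by (induction rule: rtranclp_induct) (auto elim: replacement.cases)

text \<open>Existence and uniqueness of the tabulated expressions for an admissible sequence: any table entry has
  the value of the composite of its steps, and some entry has the same start and the same steps as
  \<open>\<alpha>\<close>, hence is identified with it.\<close>

lemma adm_expr_iff:
  assumes "admissible \<alpha>" and \<phi>: "composite (steps \<alpha>) \<phi>"
  shows "adm_expr \<alpha> x y \<longleftrightarrow> x = \<phi> (gen (hd \<alpha>)) \<and> y = \<phi> (f_zero (hd \<alpha>))"
proof -
  have a: "\<alpha> \<noteq> []" "distinct_adj \<alpha>" using assms(1) by (simp_all add: admissible_def)
  have val: "x = \<phi> (gen (hd \<alpha>)) \<and> y = \<phi> (f_zero (hd \<alpha>))"
    if i: "identified \<alpha> (map (transpose 1 m) \<beta>)" and tab: "adm_table (transpose 1 m) \<beta> x y" for m \<beta> x y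
  proof -
    have "\<beta> \<noteq> []" using identified_Nil[OF i] a by simp
    then have "transpose 1 m (hd \<beta>) = hd \<alpha>" using identified_invariants(1)[OF i] by (simp add: hd_map)
    then show ?thesis
      using table_values[OF tab bij_transpose] \<phi> identified_invariants(3)[OF i] by simp
  qed
  define p where "p = transpose 1 (last \<alpha>)"
  have p: "bij p" "p 1 = last \<alpha>" by (simp_all add: p_def)
  have U: "{p 1, p 2, p 3, p 4} = UNIV" by (rule permuted_indices[OF p(1)])
  have "proper (steps \<alpha>)" using a by (simp add: distinct_adj_iff_steps)
  then obtain \<beta> x' y' where \<beta>: "adm_table p \<beta> x' y'" "last \<beta> = 1" "steps (map p \<beta>) = steps \<alpha>"
    using table_exists[OF p(1)] proper_eq_pairing_mset[OF U] by metis
  have "\<beta> \<noteq> []" using \<beta>(1) by (cases rule: adm_table.cases) (auto simp: rep_def Suc_le_eq gr0_conv_Suc)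
  then have "identified \<alpha> (map p \<beta>)"
    using a \<beta> p by (intro identified_if_last_steps) (simp_all add: last_map)
  then have "adm_expr \<alpha> (\<phi> (gen (hd \<alpha>))) (\<phi> (f_zero (hd \<alpha>)))"
    using val[of "last \<alpha>" \<beta> x' y'] \<beta>(1) unfolding adm_expr_def p_def by blast
  then show ?thesis using val unfolding adm_expr_def by blast
qed

lemma adm_e_f:
  assumes "admissible \<alpha>" "composite (steps \<alpha>) \<phi>"
  shows "adm_e \<alpha> = \<phi> (gen (hd \<alpha>))" "adm_f \<alpha> = \<phi> (f_zero (hd \<alpha>))"
  unfolding adm_e_def adm_f_def adm_expr_iff[OF assms] by auto

lemma adm_f_singleton: "adm_f [i] = f_zero i"
  using adm_e_f(2)[of "[i]" id] composite_id by (simp add: admissible_def)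

lemma composite_pairing_mset_values:
  assumes U: "{i, j, k, l} = UNIV" and \<phi>: "composite (pairing_mset i j k l t s r) \<phi>"
    and a: "{a, a'} = {k, l}" and b: "{b, b'} = {j, l}" and c: "{c, c'} = {j, k}"
  shows "\<phi> (gen i) = gen i \<sqinter> atomic a a' t \<sqinter> atomic b b' s \<sqinter> atomic c c' r"
    and "r \<ge> 1 \<Longrightarrow> \<phi> (adm_f [i]) = gen i \<sqinter> atomic a a' t \<sqinter> atomic b b' s \<sqinter> atomic c c' r \<sqinter>
      (gen i \<sqinter> atomic a a' (t + 1) \<squnion> atomic b b' (s + 1) \<sqinter> atomic c c' (r - 1))"
proof -
  show *: "\<phi> (gen i) = gen i \<sqinter> atomic a a' t \<sqinter> atomic b b' s \<sqinter> atomic c c' r"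
    using composite_gen_value[OF \<phi> U a b c] by (simp add: count_pairing_mset[OF U])
  show "\<phi> (adm_f [i]) = gen i \<sqinter> atomic a a' t \<sqinter> atomic b b' s \<sqinter> atomic c c' r \<sqinter>
      (gen i \<sqinter> atomic a a' (t + 1) \<squnion> atomic b b' (s + 1) \<sqinter> atomic c c' (r - 1))" if "r \<ge> 1"
    using composite_f_zero_sum[OF \<phi> U _ a b c] that
    by (simp add: count_pairing_mset[OF U] adm_f_singleton *)
qed

theorem theorem3p6:
  "(\<forall>i. {(adm_e \<alpha>, adm_f \<alpha>) | \<alpha>. admissible \<alpha> \<and> hd \<alpha> = i} =
        {((\<gamma> 1 2 ^^ t \<circ> \<gamma> 1 3 ^^ s \<circ> \<gamma> 1 4 ^^ r) (gen i),
          (\<gamma> 1 2 ^^ t \<circ> \<gamma> 1 3 ^^ s \<circ> \<gamma> 1 4 ^^ r) (adm_f [i])) | t s r. True}) \<and>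
   (\<forall>r s t.
      (\<gamma> 1 2 ^^ t \<circ> \<gamma> 1 3 ^^ s \<circ> \<gamma> 1 4 ^^ r) (gen 1) =
        gen 1 \<sqinter> atomic 3 4 t \<sqinter> atomic 2 4 s \<sqinter> atomic 3 2 r \<and>
      (r \<ge> 1 \<longrightarrow>
        (\<gamma> 1 2 ^^ t \<circ> \<gamma> 1 3 ^^ s \<circ> \<gamma> 1 4 ^^ r) (adm_f [1]) =
          gen 1 \<sqinter> atomic 3 4 t \<sqinter> atomic 2 4 s \<sqinter> atomic 3 2 r \<sqinter>
          (gen 1 \<sqinter> atomic 3 4 (t+1) \<squnion> atomic 2 4 (s+1) \<sqinter> atomic 3 2 (r-1))) \<and>
      (\<gamma> 1 2 ^^ t \<circ> \<gamma> 1 4 ^^ s \<circ> \<gamma> 1 3 ^^ r) (gen 2) =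
        gen 2 \<sqinter> atomic 3 4 t \<sqinter> atomic 1 4 s \<sqinter> atomic 1 3 r \<and>
      (\<gamma> 1 4 ^^ t \<circ> \<gamma> 1 3 ^^ s \<circ> \<gamma> 1 2 ^^ r) (gen 3) =
        gen 3 \<sqinter> atomic 1 4 t \<sqinter> atomic 2 4 s \<sqinter> atomic 1 2 r \<and>
      (\<gamma> 1 3 ^^ t \<circ> \<gamma> 1 2 ^^ s \<circ> \<gamma> 1 4 ^^ r) (gen 4) =
        gen 4 \<sqinter> atomic 3 1 t \<sqinter> atomic 2 1 s \<sqinter> atomic 2 3 r \<and>
      (r \<ge> 1 \<longrightarrow>
        (\<gamma> 1 2 ^^ t \<circ> \<gamma> 1 4 ^^ s \<circ> \<gamma> 1 3 ^^ r) (adm_f [2]) =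
          gen 2 \<sqinter> atomic 3 4 t \<sqinter> atomic 1 4 s \<sqinter> atomic 3 1 r \<sqinter>
          (gen 2 \<sqinter> atomic 3 4 (t+1) \<squnion> atomic 1 4 (s+1) \<sqinter> atomic 3 1 (r-1)) \<and>
        (\<gamma> 1 4 ^^ t \<circ> \<gamma> 1 3 ^^ s \<circ> \<gamma> 1 2 ^^ r) (adm_f [3]) =
          gen 3 \<sqinter> atomic 1 4 t \<sqinter> atomic 2 4 s \<sqinter> atomic 1 2 r \<sqinter>
          (gen 3 \<sqinter> atomic 1 4 (t+1) \<squnion> atomic 2 4 (s+1) \<sqinter> atomic 1 2 (r-1)) \<and>
        (\<gamma> 1 3 ^^ t \<circ> \<gamma> 1 2 ^^ s \<circ> \<gamma> 1 4 ^^ r) (adm_f [4]) =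
          gen 4 \<sqinter> atomic 3 1 t \<sqinter> atomic 2 1 s \<sqinter> atomic 3 2 r \<sqinter>
          (gen 4 \<sqinter> atomic 3 1 (t+1) \<squnion> atomic 2 1 (s+1) \<sqinter> atomic 3 2 (r-1))))"
proof -
  let ?G = "\<lambda>t s r. \<gamma> 1 2 ^^ t \<circ> \<gamma> 1 3 ^^ s \<circ> \<gamma> 1 4 ^^ r"
  note P = pairings_canonical[OF indices_UNIV]
  have c1: "composite (pairing_mset 1 2 3 4 t s r) (?G t s r)" for t s r
    by (rule composite_pairing_mset[OF indices_UNIV])
  have V2: "{2, 1, 3, 4 :: 4} = UNIV" and V3: "{3, 2, 1, 4 :: 4} = UNIV" and V4: "{4, 2, 3, 1 :: 4} = UNIV"
    and U2: "{1, 2, 4, 3 :: 4} = UNIV" and U3: "{1, 4, 3, 2 :: 4} = UNIV" and U4: "{1, 3, 2, 4 :: 4} = UNIV"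
    using indices_UNIV by (simp_all add: insert_commute)
  have c2: "composite (pairing_mset 2 1 3 4 t s r) (\<gamma> 1 2 ^^ t \<circ> \<gamma> 1 4 ^^ s \<circ> \<gamma> 1 3 ^^ r)" for t s r
    using composite_pairing_mset[OF U2, of t s r] by (simp only: pairing_mset_def P)
  have c3: "composite (pairing_mset 3 2 1 4 t s r) (\<gamma> 1 4 ^^ t \<circ> \<gamma> 1 3 ^^ s \<circ> \<gamma> 1 2 ^^ r)" for t s r
    using composite_pairing_mset[OF U3, of t s r] by (simp only: pairing_mset_def P)
  have c4: "composite (pairing_mset 4 2 3 1 t s r) (\<gamma> 1 3 ^^ t \<circ> \<gamma> 1 2 ^^ s \<circ> \<gamma> 1 4 ^^ r)" for t s r
    using composite_pairing_mset[OF U4, of t s r] by (simp only: pairing_mset_def P)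
  have ends: "{(adm_e \<alpha>, adm_f \<alpha>) | \<alpha>. admissible \<alpha> \<and> hd \<alpha> = i} =
      {(?G t s r (gen i), ?G t s r (adm_f [i])) | t s r. True}" for i
  proof (intro equalityI subsetI)
    fix z assume "z \<in> {(adm_e \<alpha>, adm_f \<alpha>) | \<alpha>. admissible \<alpha> \<and> hd \<alpha> = i}"
    then obtain \<alpha> where \<alpha>: "z = (adm_e \<alpha>, adm_f \<alpha>)" "admissible \<alpha>" "hd \<alpha> = i" by blast
    then have "proper (steps \<alpha>)" by (simp add: admissible_def distinct_adj_iff_steps)
    from proper_eq_pairing_mset[OF indices_UNIV this] obtain t s r where "steps \<alpha> = pairing_mset 1 2 3 4 t s r" by blast
    then have "composite (steps \<alpha>) (?G t s r)" using c1 by simp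
    from adm_e_f[OF \<alpha>(2) this] have "z = (?G t s r (gen i), ?G t s r (adm_f [i]))"
      by (simp only: \<alpha> adm_f_singleton)
    then show "z \<in> {(?G t s r (gen i), ?G t s r (adm_f [i])) | t s r. True}" by blast
  next
    fix z assume "z \<in> {(?G t s r (gen i), ?G t s r (adm_f [i])) | t s r. True}"
    then obtain t s r where z: "z = (?G t s r (gen i), ?G t s r (adm_f [i]))" by blast
    obtain \<alpha> where \<alpha>: "admissible \<alpha>" "hd \<alpha> = i" "steps \<alpha> = pairing_mset 1 2 3 4 t s r"
      using steps_surj[OF composite_proper[OF c1]] by blast
    then have "composite (steps \<alpha>) (?G t s r)" using c1 by simp
    from adm_e_f[OF \<alpha>(1) this] have "z = (adm_e \<alpha>, adm_f \<alpha>)" by (simp only: z \<alpha> adm_f_singleton)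
    then show "z \<in> {(adm_e \<alpha>, adm_f \<alpha>) | \<alpha>. admissible \<alpha> \<and> hd \<alpha> = i}" using \<alpha> by blast
  qed
  \<comment> \<open>The order of the upper indices is immaterial in a meet with a third generator, but not elsewhere, and the
    formulas for \<open>e\<^sub>2\<close>, \<open>e\<^sub>4\<close> use another order than those for \<open>f\<^sub>2\<^sub>0\<close>, \<open>f\<^sub>4\<^sub>0\<close>.\<close>
  note v1 = composite_pairing_mset_values[OF indices_UNIV c1, of 3 4 2 4 3 2]
  note v2 = composite_pairing_mset_values[OF V2 c2, of 3 4 1 4 1 3]
  note v2' = composite_pairing_mset_values[OF V2 c2, of 3 4 1 4 3 1]
  note v3 = composite_pairing_mset_values[OF V3 c3, of 1 4 2 4 1 2]
  note v4 = composite_pairing_mset_values[OF V4 c4, of 3 1 2 1 2 3]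
  note v4' = composite_pairing_mset_values[OF V4 c4, of 3 1 2 1 3 2]
  show ?thesis
    by (intro conjI allI impI ends v1 v2(1) v2'(2) v3 v4(1) v4'(2)) (simp_all add: insert_commute)
qed

end
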